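(* Suppose the Fuchsian equation $y''+P(z)y'+Q(z)y=0$ with coefficients given in the context, with $m_i,n_k\in\mathbb{Z}_{\geqslant 0}$, is `finite-gap' with $g$-gap associated potential $u$. Then its finite-gap solutions have the form $$Y_{1,2}(\mathbf{m},\mathbf{n};\lambda;z)=\sqrt{\Psi_{g,N}(\lambda,z)}\,\exp\left(\pm\frac{\mathrm{i}\,\nu(\lambda)}{2}\int\frac{z^{m_1}(z-1)^{m_2}(z-a)^{m_3}\prod_{k=1}^M(z-b_k)^{2n_k}\,dz}{\Psi_{g,N}(\lambda,z)\sqrt{z(z-1)(z-a)}}\right),$$ that is, these functions are solutions of the Fuchsian equation. Here $\mathrm{i}^2=-1$, $\Psi_{g,N}$ is the polynomial described in the context, and $(\nu,\lambda)$ lies on the hyperelliptic curve $$\Gamma:\quad \nu^2=\prod_{j=1}^{2g+1}(\lambda-\lambda_j),\qquad \lambda_j=\lambda(E_j),$$ where $E_j$ ($j=1,\dots,2g+1$) are the gap edges of the finite-gap elliptic potential $u(x)$.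
   Context: **The Fuchsian equation.** Fix $a\in\mathbb{C}\setminus\{0,1\}$, an integer $M\ge 0$, nonnegative integers $m_0,m_1,m_2,m_3,n_1,\dots,n_M$, and pairwise distinct $b_1,\dots,b_M\in\mathbb{C}\setminus\{0,1,a\}$; $\lambda\in\mathbb{C}$ is a parameter (spectral parameter). Put $N=\sum_{j=0}^3 m_j+2\sum_{k=1}^M n_k$, $$P(z)=\frac12\left(\frac{1-2m_1}{z}+\frac{1-2m_2}{z-1}+\frac{1-2m_3}{z-a}\right)-2\sum_{k=1}^M\frac{n_k}{z-b_k},$$ $$Q(z)=\frac{N(N-2m_0-1)z+\lambda+R_M(z)}{4z(z-1)(z-a)},\qquad R_M(z)=2\sum_{k=1}^M\frac{n_k\rho_k}{z-b_k},$$ $$\rho_k=2(b_k-1)(b_k-a)m_1+2b_k(b_k-a)m_2+2b_k(b_k-1)m_3+(3b_k^2-2(a+1)b_k+a)n_k+4\sum_{j\ne k}\frac{b_k(b_k-1)(b_k-a)}{b_k-b_j}n_j .$$ **The associated Schrödinger equation.** Let $\wp$ be a Weierstrass function with half-periods $\omega_1,\omega_2=\omega_1+\omega_3,\omega_3$, $e_i=\wp(\omega_i)$, whose lattice satisfies $(e_3-e_1)/(e_2-e_1)=a$ (the lattice is determined by $a$ up to scaling, which is immaterial). Choose $\delta_k$ with $\wp(\delta_k)=e_1+(e_2-e_1)b_k$ and put $$u(x)=m_0(m_0+1)\wp(x)+\sum_{i=1}^3 m_i(m_i+1)\wp(x-\omega_i)+\sum_{k=1}^M n_k(n_k+1)\{\wp(x-\delta_k)+\wp(x+\delta_k)\}.$$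 The change of variables $$\psi(x)=y(z)\,z^{-m_1/2}(z-1)^{-m_2/2}(z-a)^{-m_3/2}\prod_{k=1}^M(z-b_k)^{-n_k},\quad \wp(x)=e_1+(e_2-e_1)z,\quad E=(e_1-e_2)\lambda+\mathrm{const}$$ (with a suitable constant independent of $\lambda$) transforms $\psi_{xx}-u(x)\psi=E\psi$ into the Fuchsian equation $y''+P(z)y'+Q(z)y=0$; $\lambda(E)$ denotes the inverse of the affine map $\lambda\mapsto E$. **Finite-gap.** Let $J_0=u$, and let $J_{n+1}$ be determined by $\partial_xJ_{n+1}=\partial_x^3J_n-4u\,\partial_xJ_n-2u_xJ_n$ (differential polynomials in $u$). The elliptic potential $u$ is finite-gap if for some $g\ge0$ there are constants $c_m,d$ with $J_g+\sum_{m=1}^g c_mJ_{g-m}=d$; it is $g$-gap if $g$ is the minimal such integer. The Fuchsian equation is called `finite-gap' if it is obtained, via the change of variables $\psi(x)=y(z)\,z^{-m_1/2}(z-1)^{-m_2/2}(z-a)^{-m_3/2}\prod_{k=1}^M(z-b_k)^{-n_k}$, $\wp(x)=e_1+(e_2-e_1)z$, $E=(e_1-e_2)\lambda+\mathrm{const}$, from the Schrödinger equation $\psi_{xx}-u\psi=E\psi$ with finite-gap potential $u$ of the form $u(x)=m_0(m_0+1)\wp(x)+\sum_{i=1}^3 m_i(m_i+1)\wp(x-\omega_i)+\sum_{k=1}^M n_k(n_k+1)\{\wp(x-\delta_k)+\wp(x+\delta_k)\}$; solutions of a `finite-gap' equation are called finite-gap solutions. **The polynomial $\Psi_{g,N}$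 and the gap edges.** Let $\widehat\Psi(x,E)=E^g+\sum_{j=1}^g\gamma_j(x)E^{g-j}$ be the solution, monic of degree $g$ in $E$, of $\widehat\Psi_{xxx}=4(u+E)\widehat\Psi_x+2u_x\widehat\Psi$ for the $g$-gap potential $u$. Put $$\Psi_{g,N}(\lambda,z)=\mathrm{const}\cdot\widehat\Psi(x,E)\prod_{j=1}^3(\wp(x)-e_j)^{m_j}\prod_{k=1}^M(\wp(x)-\wp(\delta_k))^{2n_k},$$ where $(\lambda,z)$ and $(E,x)$ are related by $\wp(x)=e_1+(e_2-e_1)z$ and $E=(e_1-e_2)\lambda+\mathrm{const}$ (with the same additive constant as in the change of variables that transforms $\psi_{xx}-u(x)\psi=E\psi$ into the Fuchsian equation). This is a polynomial of degree $g$ in $\lambda$ and degree $N$ in $z$, and the constant is chosen so that its leading coefficient in $\lambda$ is $z^{m_1}(z-1)^{m_2}(z-a)^{m_3}\prod_{k=1}^M(z-b_k)^{2n_k}$. It solves $\Psi'''+3P\Psi''+(P'+4Q+2P^2)\Psi'+(2Q'+4PQ)\Psi=0$ (primes denote $d/dz$). The gap edges $E_1,\dots,E_{2g+1}$ of $u$ are the zeros, with multiplicity, of the spectral polynomial (monic of degree $2g+1$ in $E$, independent of $x$) $$w^2(E)=(u+E)\widehat\Psi^2+\tfrac14\widehat\Psi_x^2-\tfrac12\widehat\Psi_{xx}\widehat\Psi=\prod_{j=1}^{2g+1}(E-E_j).$$ *)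

theory Defs
  imports "HOL-Analysis.Analysis" "HOL-Computational_Algebra.Polynomial"
begin

text \<open>Conventions: \<open>m\<close> is used at indices 0 to 3, the half-periods \<open>\<omega>\<close> at 1 to 3, and
  \<open>n\<close>, \<open>b\<close>, \<open>\<delta>\<close> at 1 to \<open>M\<close>; \<open>lam\<close> is the spectral parameter.\<close>

section \<open>The Fuchsian equation\<close>

definition fuchs_N :: "(nat \<Rightarrow> nat) \<Rightarrow> nat \<Rightarrow> (nat \<Rightarrow> nat) \<Rightarrow> nat" where
  "fuchs_N m M n = (\<Sum>j=0..3. m j) + 2 * (\<Sum>k=1..M. n k)"

definition fuchs_P ::
  "complex \<Rightarrow> (nat \<Rightarrow> nat) \<Rightarrow> nat \<Rightarrow> (nat \<Rightarrow> nat) \<Rightarrow> (nat \<Rightarrow> complex) \<Rightarrow> complex \<Rightarrow> complex" where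
  "fuchs_P a m M n b z =
     1/2 * ((1 - 2 * of_nat (m 1)) / z + (1 - 2 * of_nat (m 2)) / (z - 1)
            + (1 - 2 * of_nat (m 3)) / (z - a))
     - 2 * (\<Sum>k=1..M. of_nat (n k) / (z - b k))"

definition fuchs_rho ::
  "complex \<Rightarrow> (nat \<Rightarrow> nat) \<Rightarrow> nat \<Rightarrow> (nat \<Rightarrow> nat) \<Rightarrow> (nat \<Rightarrow> complex) \<Rightarrow> nat \<Rightarrow> complex" where
  "fuchs_rho a m M n b k =
     2 * (b k - 1) * (b k - a) * of_nat (m 1) + 2 * b k * (b k - a) * of_nat (m 2)
     + 2 * b k * (b k - 1) * of_nat (m 3)
     + (3 * (b k)\<^sup>2 - 2 * (a + 1) * b k + a) * of_nat (n k)
     + 4 * (\<Sum>j\<in>{1..M} - {k}. b k * (b k - 1) * (b k - a) / (b k - b j) * of_nat (n j))"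

definition fuchs_R ::
  "complex \<Rightarrow> (nat \<Rightarrow> nat) \<Rightarrow> nat \<Rightarrow> (nat \<Rightarrow> nat) \<Rightarrow> (nat \<Rightarrow> complex) \<Rightarrow> complex \<Rightarrow> complex" where
  "fuchs_R a m M n b z = 2 * (\<Sum>k=1..M. of_nat (n k) * fuchs_rho a m M n b k / (z - b k))"

definition fuchs_Q ::
  "complex \<Rightarrow> (nat \<Rightarrow> nat) \<Rightarrow> nat \<Rightarrow> (nat \<Rightarrow> nat) \<Rightarrow> (nat \<Rightarrow> complex) \<Rightarrow> complex \<Rightarrow> complex \<Rightarrow> complex"
where
  "fuchs_Q a m M n b lam z =
     (of_nat (fuchs_N m M n) * (of_nat (fuchs_N m M n) - 2 * of_nat (m 0) - 1) * z
        + lam + fuchs_R a m M n b z)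
     / (4 * z * (z - 1) * (z - a))"

text \<open>A point \<open>b k\<close> with \<open>n k = 0\<close> is not a singularity of the equation: there the junk value of
  \<open>0 / 0\<close> is 0, so \<open>fuchs_P\<close> and \<open>fuchs_Q\<close> have the correct values.\<close>

definition fuchs_singularities :: "complex \<Rightarrow> nat \<Rightarrow> (nat \<Rightarrow> nat) \<Rightarrow> (nat \<Rightarrow> complex) \<Rightarrow> complex set" where
  "fuchs_singularities a M n b = {0, 1, a} \<union> b ` {k \<in> {1..M}. n k \<noteq> 0}"

definition fuchs_eq_at ::
  "complex \<Rightarrow> (nat \<Rightarrow> nat) \<Rightarrow> nat \<Rightarrow> (nat \<Rightarrow> nat) \<Rightarrow> (nat \<Rightarrow> complex) \<Rightarrow> complex
     \<Rightarrow> (complex \<Rightarrow> complex) \<Rightarrow> complex \<Rightarrow> bool" where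
  "fuchs_eq_at a m M n b lam y z \<longleftrightarrow>
     deriv (deriv y) z + fuchs_P a m M n b z * deriv y z + fuchs_Q a m M n b lam z * y z = 0"

definition fuchs_solution_on ::
  "complex \<Rightarrow> (nat \<Rightarrow> nat) \<Rightarrow> nat \<Rightarrow> (nat \<Rightarrow> nat) \<Rightarrow> (nat \<Rightarrow> complex) \<Rightarrow> complex
     \<Rightarrow> (complex \<Rightarrow> complex) \<Rightarrow> complex set \<Rightarrow> bool" where
  "fuchs_solution_on a m M n b lam y U \<longleftrightarrow>
     y holomorphic_on U \<and> (\<forall>z\<in>U. fuchs_eq_at a m M n b lam y z)"

section \<open>The Weierstrass function and the elliptic potential\<close>

text \<open>The condition on the imaginary part says that \<open>\<omega> 1\<close>, \<open>\<omega> 3\<close> are linearly independent over the reals.\<close>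

definition half_periods :: "(nat \<Rightarrow> complex) \<Rightarrow> bool" where
  "half_periods \<omega> \<longleftrightarrow> \<omega> 2 = \<omega> 1 + \<omega> 3 \<and> Im (\<omega> 3 / \<omega> 1) \<noteq> 0"

definition period_lattice :: "(nat \<Rightarrow> complex) \<Rightarrow> complex set" where
  "period_lattice \<omega> = {2 * of_int k * \<omega> 1 + 2 * of_int l * \<omega> 3 | k l. True}"

text \<open>The value at lattice points, where the function has poles, is meaningless.\<close>

definition wp :: "(nat \<Rightarrow> complex) \<Rightarrow> complex \<Rightarrow> complex" where
  "wp \<omega> x = 1 / x\<^sup>2 + (\<Sum>\<^sub>\<infinity>w \<in> period_lattice \<omega> - {0}. 1 / (x - w)\<^sup>2 - 1 / w\<^sup>2)"

definition wp_e :: "(nat \<Rightarrow> complex) \<Rightarrow> nat \<Rightarrow> complex" where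
  "wp_e \<omega> i = wp \<omega> (\<omega> i)"

definition elliptic_potential ::
  "(nat \<Rightarrow> complex) \<Rightarrow> (nat \<Rightarrow> nat) \<Rightarrow> nat \<Rightarrow> (nat \<Rightarrow> nat) \<Rightarrow> (nat \<Rightarrow> complex) \<Rightarrow> complex \<Rightarrow> complex"
where
  "elliptic_potential \<omega> m M n \<delta> x =
     of_nat (m 0 * (m 0 + 1)) * wp \<omega> x
     + (\<Sum>i=1..3. of_nat (m i * (m i + 1)) * wp \<omega> (x - \<omega> i))
     + (\<Sum>k=1..M. of_nat (n k * (n k + 1)) * (wp \<omega> (x - \<delta> k) + wp \<omega> (x + \<delta> k)))"

section \<open>Finite-gap potentials\<close>

text \<open>Potentials are total functions with junk values at their poles, so all identities below are
  required exactly at the points where \<open>u\<close> is analytic.\<close>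

inductive_set diff_polys :: "(complex \<Rightarrow> complex) \<Rightarrow> (complex \<Rightarrow> complex) set"
  for u :: "complex \<Rightarrow> complex" where
  self: "u \<in> diff_polys u"
| const: "(\<lambda>x. c) \<in> diff_polys u"
| add: "f \<in> diff_polys u \<Longrightarrow> h \<in> diff_polys u \<Longrightarrow> (\<lambda>x. f x + h x) \<in> diff_polys u"
| mult: "f \<in> diff_polys u \<Longrightarrow> h \<in> diff_polys u \<Longrightarrow> (\<lambda>x. f x * h x) \<in> diff_polys u"
| deriv: "f \<in> diff_polys u \<Longrightarrow> deriv f \<in> diff_polys u"

text \<open>The recursion leaves an additive constant free in each \<open>J (Suc k)\<close>. The finite-gap relation
  does not depend on these choices, since they are absorbed by the constants \<open>c\<close> and \<open>d\<close>.\<close>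

definition gap_hierarchy :: "(complex \<Rightarrow> complex) \<Rightarrow> (nat \<Rightarrow> complex \<Rightarrow> complex) \<Rightarrow> bool" where
  "gap_hierarchy u J \<longleftrightarrow>
     J 0 = u \<and>
     (\<forall>k. J k \<in> diff_polys u) \<and>
     (\<forall>k x. u analytic_on {x} \<longrightarrow>
        deriv (J (Suc k)) x
          = (deriv ^^ 3) (J k) x - 4 * u x * deriv (J k) x - 2 * deriv u x * J k x)"

definition gap_relation :: "(complex \<Rightarrow> complex) \<Rightarrow> nat \<Rightarrow> bool" where
  "gap_relation u g \<longleftrightarrow>
     (\<exists>J c d. gap_hierarchy u J \<and>
        (\<forall>x. u analytic_on {x} \<longrightarrow> J g x + (\<Sum>k=1..g. c k * J (g - k) x) = d))"

definition finite_gap :: "(complex \<Rightarrow> complex) \<Rightarrow> bool" where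
  "finite_gap u \<longleftrightarrow> (\<exists>g. gap_relation u g)"

definition g_gap :: "(complex \<Rightarrow> complex) \<Rightarrow> nat \<Rightarrow> bool" where
  "g_gap u g \<longleftrightarrow> gap_relation u g \<and> (\<forall>g'<g. \<not> gap_relation u g')"

definition psi_hat :: "nat \<Rightarrow> (nat \<Rightarrow> complex \<Rightarrow> complex) \<Rightarrow> complex \<Rightarrow> complex \<Rightarrow> complex" where
  "psi_hat g \<gamma> x E = E ^ g + (\<Sum>j=1..g. \<gamma> j x * E ^ (g - j))"

definition psi_hat_solution ::
  "(complex \<Rightarrow> complex) \<Rightarrow> nat \<Rightarrow> (nat \<Rightarrow> complex \<Rightarrow> complex) \<Rightarrow> bool" where
  "psi_hat_solution u g \<gamma> \<longleftrightarrow>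
     (\<forall>j\<in>{1..g}. \<forall>x. u analytic_on {x} \<longrightarrow> \<gamma> j analytic_on {x}) \<and>
     (\<forall>x E. u analytic_on {x} \<longrightarrow>
        (deriv ^^ 3) (\<lambda>t. psi_hat g \<gamma> t E) x
          = 4 * (u x + E) * deriv (\<lambda>t. psi_hat g \<gamma> t E) x + 2 * deriv u x * psi_hat g \<gamma> x E)"

definition spectral_w2 ::
  "(complex \<Rightarrow> complex) \<Rightarrow> nat \<Rightarrow> (nat \<Rightarrow> complex \<Rightarrow> complex) \<Rightarrow> complex \<Rightarrow> complex \<Rightarrow> complex" where
  "spectral_w2 u g \<gamma> x E =
     (u x + E) * (psi_hat g \<gamma> x E)\<^sup>2 + 1/4 * (deriv (\<lambda>t. psi_hat g \<gamma> t E) x)\<^sup>2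
     - 1/2 * (deriv ^^ 2) (\<lambda>t. psi_hat g \<gamma> t E) x * psi_hat g \<gamma> x E"

definition gap_edges ::
  "(complex \<Rightarrow> complex) \<Rightarrow> nat \<Rightarrow> (nat \<Rightarrow> complex \<Rightarrow> complex) \<Rightarrow> (nat \<Rightarrow> complex) \<Rightarrow> bool" where
  "gap_edges u g \<gamma> Ed \<longleftrightarrow>
     (\<forall>x E. u analytic_on {x} \<longrightarrow> spectral_w2 u g \<gamma> x E = (\<Prod>j=1..2*g+1. E - Ed j))"

section \<open>The change of variables\<close>

definition z_of_x :: "(nat \<Rightarrow> complex) \<Rightarrow> complex \<Rightarrow> complex" where
  "z_of_x \<omega> x = (wp \<omega> x - wp_e \<omega> 1) / (wp_e \<omega> 2 - wp_e \<omega> 1)"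

definition E_of_lambda :: "(nat \<Rightarrow> complex) \<Rightarrow> complex \<Rightarrow> complex \<Rightarrow> complex" where
  "E_of_lambda \<omega> \<kappa> lam = (wp_e \<omega> 1 - wp_e \<omega> 2) * lam + \<kappa>"

definition lambda_of_E :: "(nat \<Rightarrow> complex) \<Rightarrow> complex \<Rightarrow> complex \<Rightarrow> complex" where
  "lambda_of_E \<omega> \<kappa> E = (E - \<kappa>) / (wp_e \<omega> 1 - wp_e \<omega> 2)"

text \<open>\<open>h\<close> is any local analytic branch, as a function of \<open>x\<close>, of the factor of \<open>\<psi>\<close> with
  half-integer exponents; branches differ only by sign. "Transforms" is meant for the equation
  itself, applied to an arbitrary analytic \<open>y\<close>: wherever \<open>x\<close> and \<open>z\<close> are regular, \<open>\<psi>\<close> satisfies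
  one equation at \<open>x\<close> iff \<open>y\<close> satisfies the other at \<open>z\<close>. Only one constant \<open>\<kappa>\<close> can have this
  property.\<close>

definition transforms_to_fuchsian ::
  "complex \<Rightarrow> (nat \<Rightarrow> nat) \<Rightarrow> nat \<Rightarrow> (nat \<Rightarrow> nat) \<Rightarrow> (nat \<Rightarrow> complex)
     \<Rightarrow> (nat \<Rightarrow> complex) \<Rightarrow> (nat \<Rightarrow> complex) \<Rightarrow> complex \<Rightarrow> bool" where
  "transforms_to_fuchsian a m M n b \<omega> \<delta> \<kappa> \<longleftrightarrow>
     (\<forall>lam x h y.
        x \<notin> period_lattice \<omega> \<and> z_of_x \<omega> x \<notin> fuchs_singularities a M n b \<and>
        h analytic_on {x} \<and>
        (\<forall>\<^sub>F t in nhds x.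
           (h t)\<^sup>2 * (z_of_x \<omega> t ^ m 1 * (z_of_x \<omega> t - 1) ^ m 2 * (z_of_x \<omega> t - a) ^ m 3) = 1) \<and>
        y analytic_on {z_of_x \<omega> x} \<longrightarrow>
        (let \<psi> = (\<lambda>t. y (z_of_x \<omega> t) * h t / (\<Prod>k=1..M. (z_of_x \<omega> t - b k) ^ n k))
         in deriv (deriv \<psi>) x - elliptic_potential \<omega> m M n \<delta> x * \<psi> x = E_of_lambda \<omega> \<kappa> lam * \<psi> x
              \<longleftrightarrow> fuchs_eq_at a m M n b lam y (z_of_x \<omega> x)))"

definition associated_schroedinger ::
  "complex \<Rightarrow> (nat \<Rightarrow> nat) \<Rightarrow> nat \<Rightarrow> (nat \<Rightarrow> nat) \<Rightarrow> (nat \<Rightarrow> complex)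
     \<Rightarrow> (nat \<Rightarrow> complex) \<Rightarrow> (nat \<Rightarrow> complex) \<Rightarrow> complex \<Rightarrow> bool" where
  "associated_schroedinger a m M n b \<omega> \<delta> \<kappa> \<longleftrightarrow>
     half_periods \<omega> \<and>
     (wp_e \<omega> 3 - wp_e \<omega> 1) / (wp_e \<omega> 2 - wp_e \<omega> 1) = a \<and>
     (\<forall>k\<in>{1..M}. \<delta> k \<notin> period_lattice \<omega> \<and>
        wp \<omega> (\<delta> k) = wp_e \<omega> 1 + (wp_e \<omega> 2 - wp_e \<omega> 1) * b k) \<and>
     transforms_to_fuchsian a m M n b \<omega> \<delta> \<kappa>"

section \<open>The polynomial \<open>\<Psi>\<close>\<close>

text \<open>A polynomial in \<open>lam\<close> whose coefficients are polynomials in \<open>z\<close>.\<close>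

definition poly_lz :: "complex poly poly \<Rightarrow> complex \<Rightarrow> complex \<Rightarrow> complex" where
  "poly_lz \<Psi> lam z = poly (poly \<Psi> [:lam:]) z"

definition is_Psi ::
  "complex \<Rightarrow> (nat \<Rightarrow> nat) \<Rightarrow> nat \<Rightarrow> (nat \<Rightarrow> nat) \<Rightarrow> (nat \<Rightarrow> complex)
     \<Rightarrow> (nat \<Rightarrow> complex) \<Rightarrow> (nat \<Rightarrow> complex) \<Rightarrow> complex \<Rightarrow> nat \<Rightarrow> (nat \<Rightarrow> complex \<Rightarrow> complex)
     \<Rightarrow> complex poly poly \<Rightarrow> bool" where
  "is_Psi a m M n b \<omega> \<delta> \<kappa> g \<gamma> \<Psi> \<longleftrightarrow>
     (\<exists>C. \<forall>lam x. x \<notin> period_lattice \<omega> \<and> elliptic_potential \<omega> m M n \<delta> analytic_on {x} \<longrightarrow>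
        poly_lz \<Psi> lam (z_of_x \<omega> x)
          = C * psi_hat g \<gamma> x (E_of_lambda \<omega> \<kappa> lam)
              * (\<Prod>j=1..3. (wp \<omega> x - wp_e \<omega> j) ^ m j)
              * (\<Prod>k=1..M. (wp \<omega> x - wp \<omega> (\<delta> k)) ^ (2 * n k))) \<and>
     degree \<Psi> = g \<and>
     lead_coeff \<Psi> = [:0, 1:] ^ m 1 * [:-1, 1:] ^ m 2 * [:-a, 1:] ^ m 3
                     * (\<Prod>k=1..M. [:- b k, 1:] ^ (2 * n k))"

end

theory Submission
  imports Defs "HOL-Complex_Analysis.Complex_Analysis"
begin

text \<open>
  In the variable \<open>x\<close> the claim is the classical fact about products of solutions. If \<open>\<Phi>\<close>
  solves the third-order equation of \<open>\<psi>'' = (u + E) \<psi>\<close> with first integral \<open>w\<^sup>2\<close>, then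
  \<open>\<psi> = sqrt \<Phi> * exp (\<plusminus> \<integral> w / \<Phi>)\<close> satisfies \<open>2 \<Phi> \<psi>' = (\<Phi>' \<plusminus> 2 w) \<psi>\<close>, and differentiating once more gives
  \<open>\<psi>'' = (u + E) \<psi>\<close> (\<open>second_order_equation_from_first_order\<close>). The definition of the gap edges
  says precisely that \<open>psi_hat\<close> has the first integral \<open>\<Prod> (E - E\<^sub>j)\<close>.

  Two translations lead from there to the functions of the theorem. Comparing leading coefficients in
  \<open>lam\<close> identifies \<open>\<Psi>\<close> with \<open>psi_hat\<close> times \<open>L(z) / (e\<^sub>1 - e\<^sub>2)^g\<close>, where \<open>L\<close> is the numerator of
  the integrand (\<open>Psi_eq_leading_coefficient_times_psi_hat\<close>); as \<open>1 / L\<close> is the square of the factor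
  relating \<open>\<psi>\<close> to \<open>y\<close>, the square root of \<open>\<Psi>\<close> becomes a constant times that of \<open>psi_hat\<close>. And
  \<open>z'\<^sup>2 = 4 (e\<^sub>2 - e\<^sub>1) z (z - 1) (z - a)\<close> turns the integrand \<open>\<i> \<nu> L dz / (2 \<Psi> sqrt (z (z - 1) (z - a)))\<close> into \<open>w dx / psi_hat\<close> with
  \<open>w\<^sup>2 = (e\<^sub>1 - e\<^sub>2)^(2 g + 1) \<nu>\<^sup>2\<close>, which on the curve is \<open>\<Prod> (E - E\<^sub>j)\<close>. This differential equation for \<open>z\<close>
  is contained in the hypothesis that the change of variables transforms one equation
  into the other for every \<open>lam\<close>: it is the part of that statement linear in \<open>lam\<close>
  (\<open>z_of_x_differential_equation\<close>).

  All this happens at points \<open>x\<close> where the potential is analytic, so it proves the Fuchsian equation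
  at their images \<open>z\<close>. These are dense in the plane (\<open>regular_z_values_dense\<close>): a meromorphic function whose
  values avoid a disc around \<open>c\<close> makes \<open>1 / (f - c)\<close> bounded and entire, hence constant by
  Liouville, which the poles of the Weierstrass function exclude. The left-hand side
  of the Fuchsian equation is continuous, so density suffices. The facts about elliptic functions behind this
  are the convergence of the defining series and the double poles at the lattice points.
\<close>

section \<open>The Weierstrass function near a point\<close>

text \<open>
  Divide by \<open>2 \<omega>\<^sub>1\<close>: the imaginary part of \<open>k + l \<tau>\<close> controls \<open>l\<close>, because \<open>\<tau> = \<omega>\<^sub>3 / \<omega>\<^sub>1\<close> is not real, and
  then the real part controls \<open>k\<close>. Finiteness of the lattice in discs, injectivity of the coordinates and the convergence
  of the series all follow from this comparison.
\<close>
lemma lattice_coordinates_bounded: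
  assumes "half_periods \<omega>"
  obtains B where "B > 0"
    "\<And>k l :: int. \<bar>of_int k :: real\<bar> \<le> B * norm (2 * of_int k * \<omega> 1 + 2 * of_int l * \<omega> 3)"
    "\<And>k l :: int. \<bar>of_int l :: real\<bar> \<le> B * norm (2 * of_int k * \<omega> 1 + 2 * of_int l * \<omega> 3)"
proof -
  define \<tau> where "\<tau> = \<omega> 3 / \<omega> 1"
  define t where "t = \<bar>Im \<tau>\<bar>"
  have t: "t > 0" and \<omega>1: "\<omega> 1 \<noteq> 0"
    using assms by (auto simp: half_periods_def \<tau>_def t_def)
  define B where "B = (1 / t + (1 + norm \<tau> / t)) / (2 * norm (\<omega> 1))"
  have "B > 0"
    using t \<omega>1 unfolding B_def by (intro divide_pos_pos add_pos_nonneg) auto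
  have main: "\<bar>of_int k :: real\<bar> \<le> B * norm (2 * of_int k * \<omega> 1 + 2 * of_int l * \<omega> 3) \<and>
        \<bar>of_int l :: real\<bar> \<le> B * norm (2 * of_int k * \<omega> 1 + 2 * of_int l * \<omega> 3)" for k l :: int
  proof -
    define N where "N = norm (of_int k + of_int l * \<tau>)"
    have "2 * of_int k * \<omega> 1 + 2 * of_int l * \<omega> 3 = 2 * \<omega> 1 * (of_int k + of_int l * \<tau>)"
      using \<omega>1 by (simp add: \<tau>_def field_simps)
    hence "norm (2 * of_int k * \<omega> 1 + 2 * of_int l * \<omega> 3) = 2 * norm (\<omega> 1) * N"
      by (simp only: norm_mult N_def) simp
    hence BN: "B * norm (2 * of_int k * \<omega> 1 + 2 * of_int l * \<omega> 3) = N / t + N * (1 + norm \<tau> / t)"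
      using \<omega>1 by (simp add: B_def field_simps)
    have "\<bar>of_int l\<bar> * t = \<bar>Im (of_int k + of_int l * \<tau>)\<bar>"
      by (simp add: t_def abs_mult)
    also have "\<dots> \<le> N" unfolding N_def by (rule abs_Im_le_cmod)
    finally have l: "\<bar>of_int l\<bar> \<le> N / t" using t by (simp add: field_simps)
    have "\<bar>of_int k :: real\<bar> = norm ((of_int k + of_int l * \<tau>) - of_int l * \<tau>)" by simp
    also have "\<dots> \<le> N + \<bar>of_int l\<bar> * norm \<tau>"
      unfolding N_def by (rule order.trans[OF norm_triangle_ineq4]) (simp add: norm_mult)
    also have "\<dots> \<le> N + N / t * norm \<tau>"
      using l by (intro add_mono mult_right_mono) auto
    finally have k: "\<bar>of_int k\<bar> \<le> N * (1 + norm \<tau> / t)" by (simp add: field_simps)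
    have "0 \<le> N / t" "0 \<le> N * (1 + norm \<tau> / t)" using t by (auto simp: N_def)
    thus ?thesis using k l BN by linarith
  qed
  show ?thesis using \<open>B > 0\<close> main by (intro that) auto
qed

lemma countable_period_lattice: "countable (period_lattice \<omega>)"
proof -
  have "period_lattice \<omega> = (\<lambda>(k,l). 2 * of_int k * \<omega> 1 + 2 * of_int l * \<omega> 3) ` (UNIV :: (int \<times> int) set)"
    by (auto simp: period_lattice_def)
  thus ?thesis by simp
qed

lemma zero_in_period_lattice: "0 \<in> period_lattice \<omega>"
  unfolding period_lattice_def by (intro CollectI exI[of _ 0]) auto

lemma finite_period_lattice_cball:
  assumes "half_periods \<omega>"
  shows "finite (period_lattice \<omega> \<inter> cball 0 R)"
proof -
  obtain B where B: "B > 0"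
    "\<And>k l :: int. \<bar>of_int k :: real\<bar> \<le> B * norm (2 * of_int k * \<omega> 1 + 2 * of_int l * \<omega> 3)"
    "\<And>k l :: int. \<bar>of_int l :: real\<bar> \<le> B * norm (2 * of_int k * \<omega> 1 + 2 * of_int l * \<omega> 3)"
    using lattice_coordinates_bounded[OF assms] by blast
  define m where "m = \<lceil>B * R\<rceil>"
  have *: "k \<in> {-m..m}" if "\<bar>of_int k :: real\<bar> \<le> B * r" "r \<le> R" for k r
  proof -
    have "\<bar>of_int k :: real\<bar> \<le> B * R"
      using that B(1) by (meson less_imp_le mult_left_mono order.trans)
    thus ?thesis unfolding m_def by (simp add: ceiling_le_iff le_ceiling_iff) linarith
  qed
  have "period_lattice \<omega> \<inter> cball 0 R \<subseteq>
      (\<lambda>(k,l). 2 * of_int k * \<omega> 1 + 2 * of_int l * \<omega> 3) ` ({-m..m} \<times> {-m..m})"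
    using *[OF B(2)] *[OF B(3)] by (force simp: period_lattice_def)
  thus ?thesis by (rule finite_subset) auto
qed

lemma eventually_notin_period_lattice:
  assumes "half_periods \<omega>" "x \<notin> period_lattice \<omega>"
  shows "\<forall>\<^sub>F t in nhds x. t \<notin> period_lattice \<omega>"
proof -
  let ?L = "period_lattice \<omega> \<inter> cball 0 (norm x + 1)"
  have "open (ball x 1 - ?L)"
    by (intro open_Diff finite_imp_closed finite_period_lattice_cball assms) auto
  hence "\<forall>\<^sub>F t in nhds x. t \<in> ball x 1 - ?L"
    using assms(2) by (intro eventually_nhds_in_open) auto
  thus ?thesis
  proof eventually_elim
    case (elim t)
    have "norm t \<le> norm x + 1"
      using elim norm_triangle_ineq2[of t x] by (simp add: dist_norm norm_minus_commute)
    thus ?case using elim by auto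
  qed
qed

lemma summable_int_powr:
  "(\<lambda>k::int. (1 + \<bar>of_int k\<bar>) powr (- 3 / 2) :: real) summable_on UNIV"
proof -
  have "summable (\<lambda>n. of_nat (Suc n) powr (- 3 / 2) :: real)"
    by (subst summable_Suc_iff) (simp add: summable_real_powr_iff)
  hence nat: "(\<lambda>n. of_nat (Suc n) powr (- 3 / 2) :: real) summable_on UNIV"
    by (subst summable_on_UNIV_nonneg_real_iff) auto
  have 1: "(\<lambda>k::int. (1 + \<bar>of_int k\<bar>) powr (- 3 / 2) :: real) summable_on (range int)"
    using nat by (subst summable_on_reindex) (auto simp: o_def add_ac)
  have 2: "(\<lambda>k::int. (1 + \<bar>of_int k\<bar>) powr (- 3 / 2) :: real) summable_on (range (\<lambda>n. - int n))"
    using nat by (subst summable_on_reindex) (auto simp: o_def add_ac inj_on_def)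
  have "(UNIV :: int set) = range int \<union> (range (\<lambda>n. - int n) - range int)"
    by (auto, metis int_cases2 rangeI)
  moreover have "(\<lambda>k::int. (1 + \<bar>of_int k\<bar>) powr (- 3 / 2) :: real) summable_on
      (range int \<union> (range (\<lambda>n. - int n) - range int))"
    using 1 2 by (intro summable_on_Un_disjoint) (auto intro: summable_on_subset_banach)
  ultimately show ?thesis by simp
qed

text \<open>
  Both coordinates of a nonzero lattice point satisfy \<open>1 + \<bar>k\<bar> \<le> 2 B \<bar>w\<bar>\<close>. Splitting the exponent 3
  evenly between them bounds \<open>1 / \<bar>w\<bar>\<^sup>3\<close> by a multiple of
  \<open>(1 + \<bar>k\<bar>) powr (-3/2) * (1 + \<bar>l\<bar>) powr (-3/2)\<close>, a product of two convergent series.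
\<close>
lemma summable_lattice_inverse_cube:
  assumes "half_periods \<omega>"
  shows "(\<lambda>w. 1 / norm w ^ 3) summable_on (period_lattice \<omega> - {0})"
proof -
  obtain B where B: "B > 0"
    "\<And>k l :: int. \<bar>of_int k :: real\<bar> \<le> B * norm (2 * of_int k * \<omega> 1 + 2 * of_int l * \<omega> 3)"
    "\<And>k l :: int. \<bar>of_int l :: real\<bar> \<le> B * norm (2 * of_int k * \<omega> 1 + 2 * of_int l * \<omega> 3)"
    using lattice_coordinates_bounded[OF assms] by blast
  define g where "g = (\<lambda>k::int. (1 + \<bar>of_int k\<bar>) powr (- 3 / 2) :: real)"
  define w where "w = (\<lambda>(k,l). 2 * of_int k * \<omega> 1 + 2 * of_int l * \<omega> 3)"
  have inj: "inj w"
  proof (rule injI, clarify)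
    fix k l k' l' assume "w (k, l) = w (k', l')"
    hence "2 * of_int (k - k') * \<omega> 1 + 2 * of_int (l - l') * \<omega> 3 = 0"
      by (simp add: w_def algebra_simps)
    hence "\<bar>of_int (k - k') :: real\<bar> \<le> 0" "\<bar>of_int (l - l') :: real\<bar> \<le> 0"
      using B(2)[of "k - k'" "l - l'"] B(3)[of "l - l'" "k - k'"] by (simp_all only: norm_zero mult_zero_right)
    thus "k = k' \<and> l = l'" by simp
  qed
  have img: "period_lattice \<omega> - {0} = w ` (UNIV - {(0,0)})"
  proof -
    have "w (k,l) \<noteq> 0" if "(k,l) \<noteq> (0,0)" for k l
      using injD[OF inj, of "(k,l)" "(0,0)"] that by (auto simp: w_def)
    thus ?thesis by (auto simp: period_lattice_def w_def)
  qed
  have g: "g summable_on UNIV" unfolding g_def by (rule summable_int_powr)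
  have "(\<lambda>(k,l). g k * g l) summable_on Sigma UNIV (\<lambda>_. UNIV)"
  proof (rule summable_on_SigmaI)
    show "((\<lambda>y. case (x, y) of (k, l) \<Rightarrow> g k * g l) has_sum (g x * infsum g UNIV)) UNIV" for x
      using has_sum_cmult_right[OF has_sum_infsum[OF g]] by simp
    show "(\<lambda>x. g x * infsum g UNIV) summable_on UNIV"
      by (rule summable_on_cmult_left[OF g])
  qed (auto simp: g_def)
  hence gg: "(\<lambda>(k,l). (2 * B) ^ 3 * (g k * g l)) summable_on UNIV - {(0,0)}"
    using summable_on_cmult_right[where c = "(2 * B) ^ 3" and f = "\<lambda>(k,l). g k * g l" and A = UNIV]
    by (auto simp: case_prod_unfold intro: summable_on_subset_banach)
  have "(\<lambda>p. 1 / norm (w p) ^ 3) summable_on UNIV - {(0,0)}"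
  proof (rule summable_on_comparison_test[OF gg])
    fix p :: "int \<times> int" assume p: "p \<in> UNIV - {(0,0)}"
    obtain k l where kl: "p = (k,l)" by (cases p)
    define r where "r = norm (w p)"
    have k: "\<bar>of_int k :: real\<bar> \<le> B * r" and l: "\<bar>of_int l :: real\<bar> \<le> B * r"
      using B(2)[of k l] B(3)[of l k] by (simp_all add: r_def w_def kl)
    have "1 \<le> \<bar>of_int k :: real\<bar> \<or> 1 \<le> \<bar>of_int l :: real\<bar>"
      using p kl by (cases "k = 0") auto
    hence Br: "1 \<le> B * r" using k l by linarith
    hence r: "r > 0" using B(1) by (metis less_le_trans zero_less_mult_pos zero_less_one)
    have gb: "g j \<ge> (2 * B * r) powr (- 3 / 2)" if "\<bar>of_int j :: real\<bar> \<le> B * r" for j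
      unfolding g_def using that Br by (intro powr_mono2') auto
    have "1 / r ^ 3 = (2 * B) ^ 3 * ((2 * B * r) powr (- 3 / 2) * (2 * B * r) powr (- 3 / 2))"
    proof -
      have "(2 * B * r) powr (- 3 / 2) * (2 * B * r) powr (- 3 / 2) = (2 * B * r) powr (- 3)"
        by (simp flip: powr_add)
      also have "\<dots> = 1 / (2 * B * r) ^ 3"
        using B(1) r by (simp add: powr_minus_divide powr_numeral)
      finally show ?thesis using B(1) r by (simp add: field_simps power_mult_distrib)
    qed
    also have "\<dots> \<le> (2 * B) ^ 3 * (g k * g l)"
      using gb[OF k] gb[OF l] B(1) by (intro mult_left_mono mult_mono) (auto simp: g_def)
    finally show "1 / norm (w p) ^ 3 \<le> (case p of (k, l) \<Rightarrow> (2 * B) ^ 3 * (g k * g l))"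
      by (simp add: kl r_def)
  qed auto
  thus ?thesis
    unfolding img by (subst summable_on_reindex) (auto simp: o_def intro: inj_on_subset[OF inj])
qed

lemma wp_summand_bound:
  fixes x w :: complex
  assumes "norm x \<le> R" "norm w > 2 * R" "R > 0"
  shows "norm (1 / (x - w)\<^sup>2 - 1 / w\<^sup>2) \<le> 10 * R * (1 / norm w ^ 3)"
proof -
  have w: "norm w > 0" using assms by linarith
  have xw: "norm (x - w) \<ge> norm w / 2"
    using norm_triangle_ineq2[of w x] assms by (simp add: norm_minus_commute)
  have ne: "w \<noteq> 0" "x \<noteq> w" using w xw by auto
  have eq: "1 / (x - w)\<^sup>2 - 1 / w\<^sup>2 = x * (2 * w - x) / (w\<^sup>2 * (x - w)\<^sup>2)"
    using ne by (simp add: divide_simps) (simp add: power2_eq_square algebra_simps)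
  have "norm (2 * w - x) \<le> 5 / 2 * norm w"
    using norm_triangle_ineq4[of "2 * w" x] assms by (simp add: norm_mult)
  hence "norm x * norm (2 * w - x) \<le> R * (5 / 2 * norm w)"
    using assms by (intro mult_mono) auto
  moreover have "norm w ^ 2 * norm (x - w) ^ 2 \<ge> norm w ^ 2 * (norm w / 2) ^ 2"
    using xw by (intro mult_left_mono power_mono) auto
  ultimately have "norm x * norm (2 * w - x) / (norm w ^ 2 * norm (x - w) ^ 2) \<le>
      R * (5 / 2 * norm w) / (norm w ^ 2 * (norm w / 2) ^ 2)"
    using w assms by (intro frac_le) auto
  also have "\<dots> = 10 * R * (1 / norm w ^ 3)"
    using w by (simp add: field_simps power2_eq_square power3_eq_cube)
  finally show ?thesis by (simp add: eq norm_mult norm_divide norm_power)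
qed

text \<open>
  Only the lattice points of norm at most \<open>2 R\<close> can cause trouble in the disc of radius \<open>R\<close>; the remaining part
  of the series converges uniformly there by the Weierstrass test with majorant \<open>10 R / \<bar>w\<bar>\<^sup>3\<close>.
  The principal part at 0 stands outside the series in the definition, and the constants
  \<open>-1 / w\<^sup>2\<close> are absorbed in \<open>T\<close>, so that all lattice points appear alike.
\<close>
lemma wp_eq_principal_parts_plus_holomorphic:
  assumes "half_periods \<omega>" "R > 0"
  obtains T where "T holomorphic_on ball 0 R"
    "\<And>x. x \<in> ball 0 R \<Longrightarrow> wp \<omega> x = (\<Sum>w\<in>period_lattice \<omega> \<inter> cball 0 (2 * R). 1 / (x - w)\<^sup>2) + T x"
proof -
  define L where "L = period_lattice \<omega> \<inter> cball 0 (2 * R)"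
  define X where "X = period_lattice \<omega> - cball 0 (2 * R)"
  define f where "f = (\<lambda>w x :: complex. 1 / (x - w)\<^sup>2 - 1 / w\<^sup>2)"
  define T where "T = (\<lambda>x. \<Sum>\<^sub>\<infinity>w\<in>X. f w x)"
  have finL: "finite L" unfolding L_def by (rule finite_period_lattice_cball[OF assms(1)])
  have 0: "0 \<in> L" using assms(2) by (simp add: L_def zero_in_period_lattice)
  have bound: "norm (f w x) \<le> 10 * R * (1 / norm w ^ 3)" if "w \<in> X" "x \<in> cball 0 R" for w x
    unfolding f_def using that assms(2) by (intro wp_summand_bound) (auto simp: X_def)
  have sum: "(\<lambda>w. 10 * R * (1 / norm w ^ 3)) summable_on X"
    by (intro summable_on_cmult_right summable_on_subset_banach[OF summable_lattice_inverse_cube[OF assms(1)]])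
       (use assms(2) in \<open>auto simp: X_def\<close>)
  have "\<forall>\<^sub>F A in finite_subsets_at_top X. continuous_on (cball 0 R) (\<lambda>x. \<Sum>w\<in>A. f w x)
      \<and> (\<lambda>x. \<Sum>w\<in>A. f w x) holomorphic_on ball 0 R"
  proof (rule eventually_finite_subsets_at_top_weakI)
    fix A assume A: "finite A" "A \<subseteq> X"
    have "(\<lambda>x. \<Sum>w\<in>A. f w x) holomorphic_on cball 0 R"
      unfolding f_def using A assms(2) by (intro holomorphic_intros) (auto simp: X_def)
    thus "continuous_on (cball 0 R) (\<lambda>x. \<Sum>w\<in>A. f w x) \<and> (\<lambda>x. \<Sum>w\<in>A. f w x) holomorphic_on ball 0 R"
      by (meson ball_subset_cball holomorphic_on_imp_continuous_on holomorphic_on_subset)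
  qed
  moreover have "uniform_limit (cball 0 R) (\<lambda>A x. \<Sum>w\<in>A. f w x) T (finite_subsets_at_top X)"
    unfolding T_def by (rule Weierstrass_m_test_general[OF bound sum])
  ultimately obtain T: "T holomorphic_on ball 0 R"
    by (rule holomorphic_uniform_limit) simp
  show ?thesis
  proof (rule that[of "\<lambda>x. T x - (\<Sum>w\<in>L - {0}. 1 / w\<^sup>2)"])
    show "(\<lambda>x. T x - (\<Sum>w\<in>L - {0}. 1 / w\<^sup>2)) holomorphic_on ball 0 R"
      by (intro holomorphic_intros T)
    fix x :: complex assume x: "x \<in> ball 0 R"
    have "(\<lambda>w. norm (f w x)) summable_on X"
      using bound x by (intro Infinite_Sum.abs_summable_on_comparison_test'[OF sum]) auto
    hence s: "(\<lambda>w. f w x) summable_on X"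
      by (rule abs_summable_summable)
    have "period_lattice \<omega> - {0} = (L - {0}) \<union> X" using 0 assms(2) by (auto simp: L_def X_def)
    hence "wp \<omega> x = 1 / x\<^sup>2 + (\<Sum>\<^sub>\<infinity>w\<in>(L - {0}) \<union> X. f w x)" by (simp add: wp_def f_def)
    also have "(\<Sum>\<^sub>\<infinity>w\<in>(L - {0}) \<union> X. f w x) = (\<Sum>w\<in>L - {0}. f w x) + T x"
      using s finL by (subst infsum_Un_disjoint) (auto simp: T_def L_def X_def)
    also have "1 / x\<^sup>2 + ((\<Sum>w\<in>L - {0}. f w x) + T x) =
        (1 / (x - 0)\<^sup>2 + (\<Sum>w\<in>L - {0}. 1 / (x - w)\<^sup>2)) + (T x - (\<Sum>w\<in>L - {0}. 1 / w\<^sup>2))"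
      by (simp add: f_def sum_subtractf)
    also have "1 / (x - 0)\<^sup>2 + (\<Sum>w\<in>L - {0}. 1 / (x - w)\<^sup>2) = (\<Sum>w\<in>L. 1 / (x - w)\<^sup>2)"
      using 0 finL by (subst sum.remove[of L 0]) auto
    finally show "wp \<omega> x = (\<Sum>w\<in>period_lattice \<omega> \<inter> cball 0 (2 * R). 1 / (x - w)\<^sup>2) +
       (T x - (\<Sum>w\<in>L - {0}. 1 / w\<^sup>2))" by (simp add: L_def)
  qed
qed

lemma wp_analytic:
  assumes "half_periods \<omega>" "x \<notin> period_lattice \<omega>"
  shows "wp \<omega> analytic_on {x}"
proof -
  define R where "R = norm x + 1"
  define L where "L = period_lattice \<omega> \<inter> cball 0 (2 * R)"
  have R: "R > 0" by (simp add: R_def add_nonneg_pos)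
  obtain T where T: "T holomorphic_on ball 0 R"
    "\<And>x. x \<in> ball 0 R \<Longrightarrow> wp \<omega> x = (\<Sum>w\<in>L. 1 / (x - w)\<^sup>2) + T x"
    using wp_eq_principal_parts_plus_holomorphic[OF assms(1) R] unfolding L_def by blast
  have op: "open (ball 0 R - L)"
    unfolding L_def by (intro open_Diff finite_imp_closed finite_period_lattice_cball assms) auto
  have "(\<lambda>x. (\<Sum>w\<in>L. 1 / (x - w)\<^sup>2) + T x) holomorphic_on ball 0 R - L"
    by (intro holomorphic_intros holomorphic_on_subset[OF T(1)]) auto
  hence "wp \<omega> holomorphic_on ball 0 R - L"
    by (rule holomorphic_transform) (use T(2) in auto)
  moreover have "x \<in> ball 0 R - L" using assms(2) by (auto simp: R_def L_def)
  ultimately show ?thesis using op by (metis analytic_at)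
qed

lemma wp_double_pole:
  assumes "half_periods \<omega>" "w \<in> period_lattice \<omega>"
  obtains A where "A analytic_on {w}" "\<forall>\<^sub>F x in at w. x \<notin> period_lattice \<omega> \<and> wp \<omega> x = 1 / (x - w)\<^sup>2 + A x"
proof -
  define R where "R = norm w + 1"
  define L where "L = period_lattice \<omega> \<inter> cball 0 (2 * R)"
  have R: "R > 0" by (simp add: R_def add_nonneg_pos)
  obtain T where T: "T holomorphic_on ball 0 R"
    "\<And>x. x \<in> ball 0 R \<Longrightarrow> wp \<omega> x = (\<Sum>w\<in>L. 1 / (x - w)\<^sup>2) + T x"
    using wp_eq_principal_parts_plus_holomorphic[OF assms(1) R] unfolding L_def by blast
  have finL: "finite L"
    unfolding L_def by (intro finite_period_lattice_cball assms)
  have w: "w \<in> L" "w \<in> ball 0 R"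
    using assms(2) R by (auto simp: L_def R_def)
  have op: "open (ball 0 R - (L - {w}))"
    using finL by (intro open_Diff finite_imp_closed) auto
  define A where "A = (\<lambda>x. (\<Sum>v\<in>L - {w}. 1 / (x - v)\<^sup>2) + T x)"
  have "A holomorphic_on ball 0 R - (L - {w})"
    unfolding A_def by (intro holomorphic_intros holomorphic_on_subset[OF T(1)]) auto
  hence "A analytic_on {w}" using op w by (metis analytic_at DiffI Diff_iff singletonI)
  moreover have "\<forall>\<^sub>F x in at w. x \<in> ball 0 R - (L - {w}) - {w}"
    using op w by (intro eventually_at_in_open) auto
  hence "\<forall>\<^sub>F x in at w. x \<notin> period_lattice \<omega> \<and> wp \<omega> x = 1 / (x - w)\<^sup>2 + A x"
  proof eventually_elim
    case (elim x)
    have "wp \<omega> x = 1 / (x - w)\<^sup>2 + A x"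
      using elim T(2)[of x] w finL by (simp add: A_def sum.remove)
    thus ?case using elim R by (auto simp: L_def)
  qed
  ultimately show ?thesis by (rule that)
qed

section \<open>The values of the Weierstrass function are dense\<close>

lemma analytic_at_transform:
  assumes "f analytic_on {x}" "\<forall>\<^sub>F t in nhds x. f t = g t"
  shows "g analytic_on {x}"
  using assms analytic_at_cong[OF assms(2) refl] by simp

text \<open>
  Otherwise \<open>1 / (\<wp> - c)\<close> is bounded by \<open>1 / \<epsilon>\<close> and, with value 0 at the double poles, entire. Liouville's theorem makes it
  constantly 0, which a reciprocal cannot be.
\<close>
lemma wp_values_dense:
  assumes hp: "half_periods \<omega>" and "\<epsilon> > 0"
  shows "\<exists>x. x \<notin> period_lattice \<omega> \<and> dist (wp \<omega> x) c < \<epsilon>"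
proof (rule ccontr)
  assume no: "\<not> ?thesis"
  hence far: "norm (wp \<omega> x - c) \<ge> \<epsilon>" if "x \<notin> period_lattice \<omega>" for x
    using no that by (auto simp: dist_norm not_less)
  define f where "f = (\<lambda>x. if x \<in> period_lattice \<omega> then 0 else 1 / (wp \<omega> x - c))"
  have an: "f analytic_on {x}" for x
  proof (cases "x \<in> period_lattice \<omega>")
    case False
    have "wp \<omega> x \<noteq> c" using far[OF False] \<open>\<epsilon> > 0\<close> by auto
    hence "(\<lambda>t. 1 / (wp \<omega> t - c)) analytic_on {x}"
      by (intro analytic_intros wp_analytic hp False) auto
    moreover have "\<forall>\<^sub>F t in nhds x. 1 / (wp \<omega> t - c) = f t"
      using eventually_notin_period_lattice[OF hp False]
      by eventually_elim (simp add: f_def)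
    ultimately show ?thesis by (rule analytic_at_transform)
  next
    case True
    obtain A where A: "A analytic_on {x}"
      "\<forall>\<^sub>F t in at x. t \<notin> period_lattice \<omega> \<and> wp \<omega> t = 1 / (t - x)\<^sup>2 + A t"
      using wp_double_pole[OF hp True] by blast
    \<comment> \<open>Near a pole the reciprocal of \<open>1 / (t - x)\<^sup>2 + A t - c\<close> is rewritten so that its value at \<open>t = x\<close> is 0.\<close>
    have "(\<lambda>t. (t - x)\<^sup>2 / (1 + (t - x)\<^sup>2 * (A t - c))) analytic_on {x}"
      by (intro analytic_intros A(1)) auto
    moreover have "\<forall>\<^sub>F t in at x. (t - x)\<^sup>2 / (1 + (t - x)\<^sup>2 * (A t - c)) = f t"
      using A(2) eventually_neq_at_within[of x x UNIV]
    proof eventually_elim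
      case (elim t)
      have "(1 + (t - x)\<^sup>2 * (A t - c)) = (t - x)\<^sup>2 * (wp \<omega> t - c)"
        using elim by (simp add: field_simps)
      thus ?case using elim by (simp add: f_def)
    qed
    hence "\<forall>\<^sub>F t in nhds x. (t - x)\<^sup>2 / (1 + (t - x)\<^sup>2 * (A t - c)) = f t"
      by (subst eventually_nhds_conv_at) (simp add: f_def True)
    ultimately show ?thesis by (rule analytic_at_transform)
  qed
  have "f holomorphic_on UNIV"
    by (meson an analytic_imp_holomorphic analytic_on_analytic_at)
  moreover have "norm (f x) \<le> 1 / \<epsilon>" for x
    using far[of x] \<open>\<epsilon> > 0\<close> by (auto simp: f_def norm_divide divide_simps)
  hence "bounded (range f)" by (auto simp: bounded_iff)
  ultimately have "f constant_on UNIV" by (rule Liouville_theorem)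
  hence "f x = f 0" for x by (metis UNIV_I constant_on_def)
  hence zero: "f x = 0" for x by (simp add: f_def zero_in_period_lattice)
  have "uncountable (UNIV :: complex set)" by (simp add: uncountable_UNIV_complex)
  then obtain x where x: "x \<notin> period_lattice \<omega>"
    using countable_period_lattice by (metis UNIV_eq_I)
  have "f x \<noteq> 0" using far[OF x] x \<open>\<epsilon> > 0\<close> by (auto simp: f_def)
  thus False using zero by simp
qed

lemma wp_shift_analytic:
  assumes "half_periods \<omega>" "x - c \<notin> period_lattice \<omega>"
  shows "(\<lambda>t. wp \<omega> (t - c)) analytic_on {x}"
proof -
  have "(wp \<omega> \<circ> (\<lambda>t. t - c)) analytic_on {x}"
    by (intro analytic_on_compose analytic_intros) (simp add: wp_analytic assms)
  thus ?thesis by (simp add: o_def)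
qed

lemma z_of_x_analytic:
  assumes "half_periods \<omega>" "x \<notin> period_lattice \<omega>"
  shows "z_of_x \<omega> analytic_on {x}"
proof (cases "wp_e \<omega> 2 = wp_e \<omega> 1")
  case False
  have "(\<lambda>x. (wp \<omega> x - wp_e \<omega> 1) / (wp_e \<omega> 2 - wp_e \<omega> 1)) analytic_on {x}"
    by (intro analytic_intros wp_analytic assms) (use False in auto)
  thus ?thesis by (simp add: z_of_x_def[abs_def])
qed (simp add: z_of_x_def[abs_def])

lemma eventually_analytic_at:
  assumes "f analytic_on {x}"
  shows "\<forall>\<^sub>F t in nhds x. f analytic_on {t}"
proof -
  obtain S where "open S" "x \<in> S" "f holomorphic_on S"
    using assms analytic_at by blast
  thus ?thesis
    by (intro eventually_mono[OF eventually_nhds_in_open[of S x]]) (auto simp: analytic_at)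
qed

lemma eventually_analytic_in_open:
  assumes "f analytic_on {x}" "open V" "f x \<in> V"
  shows "\<forall>\<^sub>F t in nhds x. f t \<in> V"
proof -
  have "(f \<longlongrightarrow> f x) (at x)"
    using analytic_at_imp_isCont[OF assms(1)] by (simp add: isCont_def)
  hence "\<forall>\<^sub>F t in at x. f t \<in> V"
    using assms(2,3) by (rule topological_tendstoD)
  thus ?thesis using assms(3) by (simp add: eventually_nhds_conv_at)
qed

text \<open>
  The exceptional set consists of the translates of the lattice by the poles \<open>0\<close>, \<open>\<omega>\<^sub>i\<close> and \<open>\<plusminus>\<delta>\<^sub>k\<close>. Being countable,
  it cannot fill a disc, so every disc contains points where the potential is analytic.
\<close>
lemma elliptic_potential_analytic_off_countable:
  assumes "half_periods \<omega>"
  shows "\<exists>S. countable S \<and> period_lattice \<omega> \<subseteq> S \<and>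
           (\<forall>x. x \<notin> S \<longrightarrow> elliptic_potential \<omega> m M n \<delta> analytic_on {x})"
proof -
  define c where "c = insert 0 (\<omega> ` {1..3} \<union> \<delta> ` {1..M} \<union> (\<lambda>k. - \<delta> k) ` {1..M})"
  define S where "S = (\<Union>v\<in>c. (\<lambda>w. w + v) ` period_lattice \<omega>)"
  have "countable S"
    unfolding S_def c_def by (intro countable_UN countable_image countable_period_lattice) auto
  moreover have "period_lattice \<omega> \<subseteq> S"
    by (auto simp: S_def c_def)
  moreover have "elliptic_potential \<omega> m M n \<delta> analytic_on {x}" if x: "x \<notin> S" for x
  proof -
    have *: "x - v \<notin> period_lattice \<omega>" if "v \<in> c" for v
    proof
      assume "x - v \<in> period_lattice \<omega>"
      hence "x - v + v \<in> S" unfolding S_def using that by blast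
      thus False using x by simp
    qed
    have shift: "(\<lambda>t. wp \<omega> (t - v)) analytic_on {x}" if "v \<in> c" for v
      by (rule wp_shift_analytic[OF assms *[OF that]])
    have plus: "(\<lambda>t. wp \<omega> (t + \<delta> k)) analytic_on {x}" if "k \<in> {1..M}" for k
      using shift[of "- \<delta> k"] that by (simp add: c_def)
    have "wp \<omega> analytic_on {x}" using shift[of 0] by (simp add: c_def)
    thus ?thesis
      unfolding elliptic_potential_def[abs_def]
      by (intro analytic_on_add analytic_on_mult analytic_on_const analytic_on_sum shift plus)
         (auto simp: c_def)
  qed
  ultimately show ?thesis by blast
qed

lemma regular_z_values_dense:
  assumes hp: "half_periods \<omega>" and ne: "wp_e \<omega> 1 \<noteq> wp_e \<omega> 2" and "\<epsilon> > 0"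
  shows "\<exists>x. x \<notin> period_lattice \<omega> \<and> elliptic_potential \<omega> m M n \<delta> analytic_on {x}
           \<and> dist (z_of_x \<omega> x) c < \<epsilon>"
proof -
  define d where "d = wp_e \<omega> 2 - wp_e \<omega> 1"
  have d: "d \<noteq> 0" using ne by (simp add: d_def)
  obtain x where x: "x \<notin> period_lattice \<omega>" "dist (wp \<omega> x) (wp_e \<omega> 1 + d * c) < \<epsilon> * norm d"
    using wp_values_dense[OF hp, of "\<epsilon> * norm d" "wp_e \<omega> 1 + d * c"] d \<open>\<epsilon> > 0\<close>
    by (metis mult_pos_pos zero_less_norm_iff)
  have "z_of_x \<omega> x * d = wp \<omega> x - wp_e \<omega> 1"
    using d by (simp only: z_of_x_def d_def[symmetric]) simp
  hence "(z_of_x \<omega> x - c) * d = wp \<omega> x - (wp_e \<omega> 1 + d * c)"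
    by (simp only: left_diff_distrib) (simp add: mult.commute)
  hence "dist (z_of_x \<omega> x) c * norm d = dist (wp \<omega> x) (wp_e \<omega> 1 + d * c)"
    by (simp only: dist_norm flip: norm_mult)
  hence "dist (z_of_x \<omega> x) c * norm d < \<epsilon> * norm d" using x(2) by simp
  hence zx: "z_of_x \<omega> x \<in> ball c \<epsilon>" 
    using d by (metis dist_commute mem_ball mult_less_cancel_right_pos zero_less_norm_iff)
  have "\<forall>\<^sub>F t in nhds x. z_of_x \<omega> t \<in> ball c \<epsilon>"
    by (rule eventually_analytic_in_open[OF z_of_x_analytic[OF hp x(1)] open_ball zx])
  then obtain V where V: "open V" "x \<in> V" "\<And>t. t \<in> V \<Longrightarrow> z_of_x \<omega> t \<in> ball c \<epsilon>"
    unfolding eventually_nhds by blast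
  obtain S where S: "countable S" "period_lattice \<omega> \<subseteq> S"
    "\<forall>x. x \<notin> S \<longrightarrow> elliptic_potential \<omega> m M n \<delta> analytic_on {x}"
    using elliptic_potential_analytic_off_countable[OF hp, of m M n \<delta>] by blast
  obtain e where e: "e > 0" "ball x e \<subseteq> V" using V(1,2) by (rule openE)
  have "\<not> ball x e \<subseteq> S"
    using uncountable_ball[OF e(1), of x] countable_subset[OF _ S(1)] by metis
  then obtain t where "t \<in> V" "t \<notin> S" using e(2) by blast
  hence "t \<notin> period_lattice \<omega>" "elliptic_potential \<omega> m M n \<delta> analytic_on {t}"
      "dist (z_of_x \<omega> t) c < \<epsilon>"
    using S(2) S(3) V(3)[of t] by (auto simp: dist_commute)
  thus ?thesis by blast
qed

section \<open>The change of variables\<close>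

lemma analytic_inverse_sqrt:
  fixes f :: "complex \<Rightarrow> complex"
  assumes "f analytic_on {x}" "f x \<noteq> 0"
  obtains h where "h analytic_on {x}" "\<forall>\<^sub>F t in nhds x. (h t)\<^sup>2 * f t = 1"
proof
  define h where "h = (\<lambda>t. csqrt (1 / f x) * csqrt (f x / f t))"
  show "h analytic_on {x}"
    unfolding h_def by (intro analytic_intros assms) (use assms in \<open>auto simp: complex_nonpos_Reals_iff\<close>)
  have "\<forall>\<^sub>F t in nhds x. f t \<in> - {0}"
    using assms by (intro eventually_analytic_in_open) auto
  thus "\<forall>\<^sub>F t in nhds x. (h t)\<^sup>2 * f t = 1"
    by eventually_elim (use assms(2) in \<open>auto simp: h_def power_mult_distrib\<close>)
qed

text \<open>
  This is how the change of variables acts on a trial function \<open>1 - q (\<zeta> - z)\<^sup>2\<close>: because \<open>(\<zeta> - z)\<^sup>2\<close> vanishes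
  to second order, \<open>q\<close> enters with the coefficient \<open>z'\<^sup>2\<close> alone, without \<open>z''\<close> or derivatives of the gauge factor.
\<close>
lemma deriv2_mult_double_zero:
  fixes f p :: "complex \<Rightarrow> complex"
  assumes "f analytic_on {x}" "p analytic_on {x}" "p x = 0"
  shows "deriv (deriv (\<lambda>t. f t * (1 - q * (p t)\<^sup>2))) x = deriv (deriv f) x - 2 * q * f x * (deriv p x)\<^sup>2"
proof -
  have "\<forall>\<^sub>F t in nhds x. deriv (\<lambda>t. f t * (1 - q * (p t)\<^sup>2)) t
        = deriv f t * (1 - q * (p t)\<^sup>2) - f t * (2 * q * p t * deriv p t)"
    using eventually_analytic_at[OF assms(1)] eventually_analytic_at[OF assms(2)]
  proof eventually_elim
    case (elim t)
    show ?case
      by (rule DERIV_imp_deriv)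
         (auto intro!: derivative_eq_intros analytic_derivI elim simp: algebra_simps)
  qed
  hence "deriv (deriv (\<lambda>t. f t * (1 - q * (p t)\<^sup>2))) x
      = deriv (\<lambda>t. deriv f t * (1 - q * (p t)\<^sup>2) - f t * (2 * q * p t * deriv p t)) x"
    by (intro deriv_cong_ev) auto
  also have "\<dots> = deriv (deriv f) x - 2 * q * f x * (deriv p x)\<^sup>2"
    by (rule DERIV_imp_deriv)
       (auto intro!: derivative_eq_intros analytic_derivI assms analytic_deriv
             simp: assms(3) power2_eq_square algebra_simps)
  finally show ?thesis .
qed

lemma half_period_values_distinct:
  assumes "associated_schroedinger a m M n b \<omega> \<delta> \<kappa>" "a \<noteq> 0"
  shows "wp_e \<omega> 1 \<noteq> wp_e \<omega> 2"
  using assms by (auto simp: associated_schroedinger_def)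

text \<open>
  The branch of \<open>z^(-m\<^sub>1/2) (z-1)^(-m\<^sub>2/2) (z-a)^(-m\<^sub>3/2)\<close> in the change of variables.
\<close>
lemma gauge_factor:
  assumes as: "associated_schroedinger a m M n b \<omega> \<delta> \<kappa>"
    and x: "x \<notin> period_lattice \<omega>" "z_of_x \<omega> x \<notin> fuchs_singularities a M n b"
  obtains h where "h analytic_on {x}"
    "\<forall>\<^sub>F t in nhds x.
       (h t)\<^sup>2 * (z_of_x \<omega> t ^ m 1 * (z_of_x \<omega> t - 1) ^ m 2 * (z_of_x \<omega> t - a) ^ m 3) = 1"
proof -
  have hp: "half_periods \<omega>" using as by (simp add: associated_schroedinger_def)
  show ?thesis
    by (rule analytic_inverse_sqrt[of "\<lambda>t. z_of_x \<omega> t ^ m 1 * (z_of_x \<omega> t - 1) ^ m 2 * (z_of_x \<omega> t - a) ^ m 3" x])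
       (use x that in \<open>auto simp: fuchs_singularities_def intro!: analytic_intros z_of_x_analytic[OF hp x(1)]\<close>)
qed

lemma schroedinger_iff_fuchsian:
  assumes as: "associated_schroedinger a m M n b \<omega> \<delta> \<kappa>"
    and x: "x \<notin> period_lattice \<omega>" "z_of_x \<omega> x \<notin> fuchs_singularities a M n b"
    and h: "h analytic_on {x}"
      "\<forall>\<^sub>F t in nhds x.
         (h t)\<^sup>2 * (z_of_x \<omega> t ^ m 1 * (z_of_x \<omega> t - 1) ^ m 2 * (z_of_x \<omega> t - a) ^ m 3) = 1"
    and y: "y analytic_on {z_of_x \<omega> x}"
  defines "\<psi> \<equiv> \<lambda>t. y (z_of_x \<omega> t) * h t / (\<Prod>k=1..M. (z_of_x \<omega> t - b k) ^ n k)"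
  shows "deriv (deriv \<psi>) x = (elliptic_potential \<omega> m M n \<delta> x + E_of_lambda \<omega> \<kappa> lam) * \<psi> x
           \<longleftrightarrow> fuchs_eq_at a m M n b lam y (z_of_x \<omega> x)"
proof -
  have "transforms_to_fuchsian a m M n b \<omega> \<delta> \<kappa>"
    using as by (simp add: associated_schroedinger_def)
  hence "deriv (deriv \<psi>) x - elliptic_potential \<omega> m M n \<delta> x * \<psi> x = E_of_lambda \<omega> \<kappa> lam * \<psi> x
           \<longleftrightarrow> fuchs_eq_at a m M n b lam y (z_of_x \<omega> x)"
    unfolding transforms_to_fuchsian_def Let_def \<psi>_def using x h y by blast
  thus ?thesis by (simp add: algebra_simps)
qed

lemma denominator_nonzero:
  assumes "z \<notin> fuchs_singularities a M n b"
  shows "(\<Prod>k=1..M. (z - b k) ^ n k) \<noteq> 0"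
  using assms by (auto simp: fuchs_singularities_def)

text \<open>
  This is the equation \<open>\<wp>'\<^sup>2 = 4 (\<wp> - e\<^sub>1) (\<wp> - e\<^sub>2) (\<wp> - e\<^sub>3)\<close>, written in \<open>z\<close>. For each value of \<open>lam\<close> the trial function
  \<open>1 - Q/2 (\<zeta> - z)\<^sup>2\<close> satisfies the Fuchsian equation at the single point \<open>z\<close>, hence its transform satisfies
  the Schroedinger equation at \<open>x\<close>. Subtracting the resulting identities for \<open>lam = 0\<close> and \<open>lam = 1\<close> eliminates the potential and
  leaves \<open>z'\<^sup>2 / (4 z (z - 1) (z - a)) = e\<^sub>2 - e\<^sub>1\<close>.
\<close>
lemma z_of_x_differential_equation:
  assumes as: "associated_schroedinger a m M n b \<omega> \<delta> \<kappa>"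
    and x: "x \<notin> period_lattice \<omega>" "z_of_x \<omega> x \<notin> fuchs_singularities a M n b"
  shows "(deriv (z_of_x \<omega>) x)\<^sup>2
           = 4 * (wp_e \<omega> 2 - wp_e \<omega> 1) * (z_of_x \<omega> x * (z_of_x \<omega> x - 1) * (z_of_x \<omega> x - a))"
proof -
  define z where "z = z_of_x \<omega> x"
  define u where "u = elliptic_potential \<omega> m M n \<delta> x"
  have hp: "half_periods \<omega>" using as by (simp add: associated_schroedinger_def)
  note Z = z_of_x_analytic[OF hp x(1)]
  obtain h where h: "h analytic_on {x}"
    "\<forall>\<^sub>F t in nhds x.
       (h t)\<^sup>2 * (z_of_x \<omega> t ^ m 1 * (z_of_x \<omega> t - 1) ^ m 2 * (z_of_x \<omega> t - a) ^ m 3) = 1"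
    using gauge_factor[OF as x] by blast
  have hx: "h x \<noteq> 0" using eventually_nhds_x_imp_x[OF h(2)] by auto
  define H where "H = (\<lambda>t. h t / (\<Prod>k=1..M. (z_of_x \<omega> t - b k) ^ n k))"
  have H: "H analytic_on {x}"
    unfolding H_def using denominator_nonzero[OF x(2)] by (intro analytic_intros h Z) auto
  have Hx: "H x \<noteq> 0"
    using hx denominator_nonzero[OF x(2)] by (simp add: H_def)
  have key: "deriv (deriv H) x - fuchs_Q a m M n b lam z * H x * (deriv (z_of_x \<omega>) x)\<^sup>2
      = (u + E_of_lambda \<omega> \<kappa> lam) * H x" for lam
  proof -
    define q where "q = fuchs_Q a m M n b lam z / 2"
    define y where "y = (\<lambda>\<zeta>. 1 - q * (\<zeta> - z)\<^sup>2)"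
    have y: "y analytic_on {z}" unfolding y_def by (intro analytic_intros)
    have y': "deriv y = (\<lambda>\<zeta>. - 2 * q * (\<zeta> - z))"
      unfolding y_def by (rule ext, rule DERIV_imp_deriv) (auto intro!: derivative_eq_intros)
    have y'': "deriv (deriv y) z = - 2 * q"
      unfolding y' by (rule DERIV_imp_deriv) (auto intro!: derivative_eq_intros)
    have "deriv y z = 0" by (simp add: y')
    moreover have "y z = 1" by (simp add: y_def)
    ultimately have "fuchs_eq_at a m M n b lam y z"
      by (simp add: fuchs_eq_at_def y'' q_def)
    hence ode: "deriv (deriv (\<lambda>t. y (z_of_x \<omega> t) * h t / (\<Prod>k=1..M. (z_of_x \<omega> t - b k) ^ n k))) x
        = (u + E_of_lambda \<omega> \<kappa> lam) * (y (z_of_x \<omega> x) * h x / (\<Prod>k=1..M. (z_of_x \<omega> x - b k) ^ n k))"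
      using schroedinger_iff_fuchsian[OF as x h, of y lam] y by (simp add: z_def u_def)
    have prod: "(\<lambda>t. y (z_of_x \<omega> t) * h t / (\<Prod>k=1..M. (z_of_x \<omega> t - b k) ^ n k))
        = (\<lambda>t. H t * (1 - q * (z_of_x \<omega> t - z)\<^sup>2))"
      by (simp add: H_def y_def mult.commute)
    have at_x: "y (z_of_x \<omega> x) * h x / (\<Prod>k=1..M. (z_of_x \<omega> x - b k) ^ n k) = H x"
      by (simp add: y_def H_def z_def)
    have "deriv (deriv (\<lambda>t. H t * (1 - q * (z_of_x \<omega> t - z)\<^sup>2))) x = (u + E_of_lambda \<omega> \<kappa> lam) * H x"
      using ode unfolding prod at_x .
    moreover have "deriv (\<lambda>t. z_of_x \<omega> t - z) x = deriv (z_of_x \<omega>) x"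
      by (rule DERIV_imp_deriv) (auto intro!: derivative_eq_intros analytic_derivI Z)
    ultimately show ?thesis
      by (subst (asm) deriv2_mult_double_zero) (auto intro!: analytic_intros H Z simp: z_def q_def)
  qed
  define p where "p = z * (z - 1) * (z - a)"
  have p: "p \<noteq> 0" using x(2) by (auto simp: p_def fuchs_singularities_def z_def)
  have Q: "fuchs_Q a m M n b 1 z - fuchs_Q a m M n b 0 z = 1 / (4 * p)"
    by (simp add: fuchs_Q_def p_def add_divide_distrib mult.assoc)
  have "(fuchs_Q a m M n b 1 z - fuchs_Q a m M n b 0 z) * (deriv (z_of_x \<omega>) x)\<^sup>2 * H x
      = (E_of_lambda \<omega> \<kappa> 0 - E_of_lambda \<omega> \<kappa> 1) * H x"
    using key[of 0] key[of 1] by (simp add: algebra_simps)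
  hence "1 / (4 * p) * (deriv (z_of_x \<omega>) x)\<^sup>2 = E_of_lambda \<omega> \<kappa> 0 - E_of_lambda \<omega> \<kappa> 1"
    using Hx unfolding Q by (metis mult_right_cancel)
  hence "(deriv (z_of_x \<omega>) x)\<^sup>2 = 4 * (wp_e \<omega> 2 - wp_e \<omega> 1) * p"
    using p by (simp add: E_of_lambda_def divide_eq_eq mult_ac)
  thus ?thesis by (simp only: p_def z_def)
qed

section \<open>Solutions of the Schroedinger equation in product form\<close>

text \<open>
  Applied to a multiple of \<open>z' / sqrt (z (z - 1) (z - a))\<close>, whose square is known to be constant: the choice of the
  square root of the cubic can only affect the sign of the exponent.
\<close>
lemma deriv_zero_if_square_constant:
  fixes W :: "complex \<Rightarrow> complex"
  assumes "W analytic_on {x}" "\<forall>\<^sub>F t in nhds x. (W t)\<^sup>2 = c"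
  shows "deriv W x = 0"
proof (cases "c = 0")
  case True
  hence "deriv W x = deriv (\<lambda>_. 0) x"
    using assms(2) by (intro deriv_cong_ev) auto
  thus ?thesis by simp
next
  case False
  have "((\<lambda>t. (W t)\<^sup>2) has_field_derivative 2 * W x * deriv W x) (at x)"
    by (auto intro!: derivative_eq_intros analytic_derivI assms)
  moreover have "((\<lambda>t. (W t)\<^sup>2) has_field_derivative 0) (at x)"
    using DERIV_cong_ev[OF refl assms(2) refl, of 0] by simp
  ultimately have "2 * W x * deriv W x = 0" using DERIV_unique by blast
  moreover have "W x \<noteq> 0" using False eventually_nhds_x_imp_x[OF assms(2)] by auto
  ultimately show ?thesis by simp
qed

lemma deriv_of_square_root:
  fixes \<sigma> \<Phi> :: "complex \<Rightarrow> complex"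
  assumes "\<sigma> analytic_on {x}" "\<Phi> analytic_on {x}" "k \<noteq> 0"
    and sq: "\<forall>\<^sub>F t in nhds x. k * (\<sigma> t)\<^sup>2 = \<Phi> t"
  shows "2 * \<Phi> x * deriv \<sigma> x = deriv \<Phi> x * \<sigma> x"
proof -
  have "((\<lambda>t. k * (\<sigma> t)\<^sup>2) has_field_derivative k * (2 * \<sigma> x * deriv \<sigma> x)) (at x)"
    by (auto intro!: derivative_eq_intros analytic_derivI assms)
  hence "deriv \<Phi> x = k * (2 * \<sigma> x * deriv \<sigma> x)"
    using DERIV_cong_ev[OF refl sq refl] by (metis DERIV_imp_deriv)
  moreover have "\<Phi> x = k * (\<sigma> x)\<^sup>2" using eventually_nhds_x_imp_x[OF sq] by simp
  ultimately show ?thesis by (simp add: power2_eq_square algebra_simps)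
qed

text \<open>
  Differentiating the first-order equation gives \<open>2 \<Phi> \<psi>'' = \<Phi>'' \<psi> + (2 W - \<Phi>') \<psi>'\<close>. Multiplying by \<open>2 \<Phi>\<close> and using the
  first-order equation again, \<open>\<psi>'\<close> drops out and the factor \<open>(2 W - \<Phi>') (2 W + \<Phi>') = 4 W\<^sup>2 - \<Phi>'\<^sup>2\<close> appears,
  which the formula for \<open>W\<^sup>2\<close> evaluates.
\<close>
lemma second_order_equation_from_first_order:
  fixes \<psi> \<Phi> W :: "complex \<Rightarrow> complex"
  assumes an: "\<psi> analytic_on {x}" "\<Phi> analytic_on {x}" "W analytic_on {x}"
    and W: "deriv W x = 0"
    and first: "\<forall>\<^sub>F t in nhds x. 2 * \<Phi> t * deriv \<psi> t = (deriv \<Phi> t + 2 * W t) * \<psi> t"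
    and "\<Phi> x \<noteq> 0"
    and W2: "(W x)\<^sup>2 = q * (\<Phi> x)\<^sup>2 + 1/4 * (deriv \<Phi> x)\<^sup>2 - 1/2 * deriv (deriv \<Phi>) x * \<Phi> x"
  shows "deriv (deriv \<psi>) x = q * \<psi> x"
proof -
  define p p1 p2 f f1 f2 w where "p = \<psi> x" "p1 = deriv \<psi> x" "p2 = deriv (deriv \<psi>) x"
    "f = \<Phi> x" "f1 = deriv \<Phi> x" "f2 = deriv (deriv \<Phi>) x" "w = W x"
  have "((\<lambda>t. 2 * \<Phi> t * deriv \<psi> t) has_field_derivative 2 * (f1 * p1 + f * p2)) (at x)"
    unfolding p_p1_p2_f_f1_f2_w_def
    by (auto intro!: derivative_eq_intros analytic_derivI an analytic_deriv)
  moreover have "((\<lambda>t. (deriv \<Phi> t + 2 * W t) * \<psi> t) has_field_derivative f2 * p + (f1 + 2 * w) * p1) (at x)"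
    unfolding p_p1_p2_f_f1_f2_w_def
    by (auto intro!: derivative_eq_intros analytic_derivI an analytic_deriv simp: W)
  hence "((\<lambda>t. 2 * \<Phi> t * deriv \<psi> t) has_field_derivative f2 * p + (f1 + 2 * w) * p1) (at x)"
    using DERIV_cong_ev[OF refl first refl] by simp
  ultimately have 2: "2 * (f1 * p1 + f * p2) = f2 * p + (f1 + 2 * w) * p1"
    by (rule DERIV_unique)
  have 1: "2 * f * p1 = (f1 + 2 * w) * p"
    using eventually_nhds_x_imp_x[OF first] by (simp add: p_p1_p2_f_f1_f2_w_def)
  have 3: "4 * w\<^sup>2 = 4 * q * f\<^sup>2 + f1\<^sup>2 - 2 * f2 * f"
    unfolding p_p1_p2_f_f1_f2_w_def W2 by (simp add: algebra_simps)
  have "4 * f\<^sup>2 * p2 = 2 * f * f2 * p + (2 * w - f1) * (2 * f * p1)"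
    using 2 by algebra
  also have "\<dots> = 4 * f\<^sup>2 * (q * p)"
    unfolding 1 using 3 by algebra
  finally show ?thesis using \<open>\<Phi> x \<noteq> 0\<close> by (simp add: p_p1_p2_f_f1_f2_w_def)
qed

section \<open>The polynomial in both variables\<close>

text \<open>
  At a fixed point both sides are polynomials in \<open>lam\<close>. On the right only \<open>E^g\<close> contributes to the
  coefficient of \<open>lam^g\<close>, because \<open>E\<close> is affine in \<open>lam\<close> and \<open>psi_hat\<close> is monic in \<open>E\<close>.
\<close>
lemma leading_coefficient_in_energy:
  fixes \<Psi> :: "complex poly poly"
  assumes eq: "\<And>lam. poly_lz \<Psi> lam z = K * psi_hat g \<gamma> x (d * lam + \<kappa>)" and deg: "degree \<Psi> = g"
  shows "poly (lead_coeff \<Psi>) z = K * d ^ g"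
proof -
  define p where "p = map_poly (\<lambda>c. poly c z) \<Psi>"
  define q where "q = smult K ([:\<kappa>, d:] ^ g + (\<Sum>j=1..g. smult (\<gamma> j x) ([:\<kappa>, d:] ^ (g - j))))"
  have "poly p lam = poly_lz \<Psi> lam z" for lam
    unfolding p_def poly_lz_def by (induction \<Psi>) (auto simp: map_poly_pCons)
  moreover have "poly q lam = K * psi_hat g \<gamma> x (d * lam + \<kappa>)" for lam
    by (simp add: q_def psi_hat_def poly_sum poly_power algebra_simps)
  ultimately have "poly p = poly q" by (intro ext) (simp add: eq)
  hence "p = q" by (simp add: poly_eq_poly_eq_iff)
  have small: "coeff ([:\<kappa>, d:] ^ k) g = 0" if "k < g" for k
  proof (rule coeff_eq_0)
    have "degree ([:\<kappa>, d:] ^ k) \<le> degree [:\<kappa>, d:] * k" by (rule degree_power_le)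
    also have "\<dots> \<le> k" by simp
    finally show "degree ([:\<kappa>, d:] ^ k) < g" using that by simp
  qed
  have "poly (lead_coeff \<Psi>) z = coeff p g"
    by (simp add: p_def coeff_map_poly deg)
  also have "\<dots> = K * d ^ g"
    unfolding \<open>p = q\<close> q_def
    by (auto simp: coeff_sum small coeff_linear_poly_power intro!: sum.neutral)
  finally show ?thesis .
qed

text \<open>
  The unknown constant and the products of powers of \<open>\<wp> - e\<^sub>j\<close> and \<open>\<wp> - \<wp>(\<delta>\<^sub>k)\<close> in the definition of \<open>\<Psi>\<close> form one factor
  independent of \<open>lam\<close>; the normalization of the leading coefficient determines it.
\<close>
lemma Psi_eq_leading_coefficient_times_psi_hat:
  assumes Psi: "is_Psi a m M n b \<omega> \<delta> \<kappa> g \<gamma> \<Psi>"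
    and ne: "wp_e \<omega> 1 \<noteq> wp_e \<omega> 2"
    and x: "x \<notin> period_lattice \<omega>" "elliptic_potential \<omega> m M n \<delta> analytic_on {x}"
  shows "(wp_e \<omega> 1 - wp_e \<omega> 2) ^ g * poly_lz \<Psi> lam (z_of_x \<omega> x)
           = poly (lead_coeff \<Psi>) (z_of_x \<omega> x) * psi_hat g \<gamma> x (E_of_lambda \<omega> \<kappa> lam)"
proof -
  obtain C where C: "\<And>lam. poly_lz \<Psi> lam (z_of_x \<omega> x)
      = C * psi_hat g \<gamma> x (E_of_lambda \<omega> \<kappa> lam) * (\<Prod>j=1..3. (wp \<omega> x - wp_e \<omega> j) ^ m j)
          * (\<Prod>k=1..M. (wp \<omega> x - wp \<omega> (\<delta> k)) ^ (2 * n k))"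
    using Psi x unfolding is_Psi_def by blast
  define K where "K = C * (\<Prod>j=1..3. (wp \<omega> x - wp_e \<omega> j) ^ m j)
          * (\<Prod>k=1..M. (wp \<omega> x - wp \<omega> (\<delta> k)) ^ (2 * n k))"
  have K: "poly_lz \<Psi> lam (z_of_x \<omega> x) = K * psi_hat g \<gamma> x (E_of_lambda \<omega> \<kappa> lam)" for lam
    by (simp add: C K_def)
  have "poly (lead_coeff \<Psi>) (z_of_x \<omega> x) = K * (wp_e \<omega> 1 - wp_e \<omega> 2) ^ g"
    by (rule leading_coefficient_in_energy[of _ _ _ _ _ x _ \<kappa>])
       (use K Psi in \<open>auto simp: E_of_lambda_def is_Psi_def\<close>)
  thus ?thesis by (simp add: K)
qed

lemma poly_lead_coeff_Psi:
  assumes "is_Psi a m M n b \<omega> \<delta> \<kappa> g \<gamma> \<Psi>"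
  shows "poly (lead_coeff \<Psi>) z
    = z ^ m 1 * (z - 1) ^ m 2 * (z - a) ^ m 3 * (\<Prod>k=1..M. (z - b k) ^ (2 * n k))"
proof -
  have "lead_coeff \<Psi> = [:0, 1:] ^ m 1 * [:-1, 1:] ^ m 2 * [:-a, 1:] ^ m 3
                     * (\<Prod>k=1..M. [:- b k, 1:] ^ (2 * n k))"
    using assms unfolding is_Psi_def by blast
  thus ?thesis by (simp add: poly_prod poly_power)
qed

lemma psi_hat_analytic:
  assumes "psi_hat_solution u g \<gamma>" "u analytic_on {x}"
  shows "(\<lambda>t. psi_hat g \<gamma> t E) analytic_on {x}"
  unfolding psi_hat_def by (intro analytic_intros) (use assms in \<open>auto simp: psi_hat_solution_def\<close>)

lemma curve_in_energy:
  assumes "wp_e \<omega> 1 \<noteq> wp_e \<omega> 2"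
  shows "(\<Prod>j=1..N. E_of_lambda \<omega> \<kappa> lam - Ed j)
           = (wp_e \<omega> 1 - wp_e \<omega> 2) ^ N * (\<Prod>j=1..N. lam - lambda_of_E \<omega> \<kappa> (Ed j))"
proof -
  have "E_of_lambda \<omega> \<kappa> lam - Ed j = (wp_e \<omega> 1 - wp_e \<omega> 2) * (lam - lambda_of_E \<omega> \<kappa> (Ed j))" for j
    using assms by (simp add: E_of_lambda_def lambda_of_E_def field_simps)
  thus ?thesis by (simp add: prod.distrib)
qed

section \<open>The finite-gap solutions\<close>

text \<open>
  The transform \<open>\<psi>\<close> of the proposed solution is \<open>\<sigma> exp (\<integral> W / \<Phi>)\<close> with \<open>(e\<^sub>1 - e\<^sub>2)^g \<sigma>\<^sup>2 = \<Phi>\<close> and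
  \<open>W\<^sup>2 = \<Prod> (E - E\<^sub>j)\<close>, so it satisfies the Schroedinger equation. Everything takes place in a neighbourhood \<open>V\<close> of \<open>x\<close>
  in which \<open>u\<close> and the factor \<open>h\<close> of the change of variables are analytic and \<open>z\<close> stays in \<open>U\<close>.
\<close>
lemma finite_gap_solution_at_regular_point:
  fixes a \<kappa> lam \<nu> :: complex
  assumes a: "a \<noteq> 0"
    and as: "associated_schroedinger a m M n b \<omega> \<delta> \<kappa>"
    and Psi_hat: "psi_hat_solution (elliptic_potential \<omega> m M n \<delta>) g \<gamma>"
    and Psi: "is_Psi a m M n b \<omega> \<delta> \<kappa> g \<gamma> \<Psi>"
    and edges: "gap_edges (elliptic_potential \<omega> m M n \<delta>) g \<gamma> Ed"
    and curve: "\<nu>\<^sup>2 = (\<Prod>j=1..2*g+1. lam - lambda_of_E \<omega> \<kappa> (Ed j))"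
    and U: "open U" "U \<inter> fuchs_singularities a M n b = {}" "\<forall>z\<in>U. poly_lz \<Psi> lam z \<noteq> 0"
    and s: "s holomorphic_on U" "\<forall>z\<in>U. (s z)\<^sup>2 = poly_lz \<Psi> lam z"
    and r: "r holomorphic_on U" "\<forall>z\<in>U. (r z)\<^sup>2 = z * (z - 1) * (z - a)"
    and F: "\<forall>z\<in>U. (F has_field_derivative
          z ^ m 1 * (z - 1) ^ m 2 * (z - a) ^ m 3 * (\<Prod>k=1..M. (z - b k) ^ (2 * n k))
          / (poly_lz \<Psi> lam z * r z)) (at z)"
    and x: "x \<notin> period_lattice \<omega>" "elliptic_potential \<omega> m M n \<delta> analytic_on {x}" "z_of_x \<omega> x \<in> U"
  shows "fuchs_eq_at a m M n b lam (\<lambda>z. s z * exp (\<i> * \<nu> / 2 * F z)) (z_of_x \<omega> x)"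
proof -
  define Z where "Z = z_of_x \<omega>"
  define u where "u = elliptic_potential \<omega> m M n \<delta>"
  define d where "d = wp_e \<omega> 1 - wp_e \<omega> 2"
  define \<Phi> where "\<Phi> = (\<lambda>t. psi_hat g \<gamma> t (E_of_lambda \<omega> \<kappa> lam))"
  define B where "B = (\<lambda>t. \<Prod>k=1..M. (Z t - b k) ^ n k)"
  have hp: "half_periods \<omega>" using as by (simp add: associated_schroedinger_def)
  have ne: "wp_e \<omega> 1 \<noteq> wp_e \<omega> 2" by (rule half_period_values_distinct[OF as a])
  hence d: "d \<noteq> 0" by (simp add: d_def)
  have sing: "Z t \<notin> fuchs_singularities a M n b" if "Z t \<in> U" for t using U(2) that by blast
  have Z: "Z analytic_on {t}" if "t \<notin> period_lattice \<omega>" for t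
    unfolding Z_def by (rule z_of_x_analytic[OF hp that])
  obtain h where h: "h analytic_on {x}"
    "\<forall>\<^sub>F t in nhds x. (h t)\<^sup>2 * (Z t ^ m 1 * (Z t - 1) ^ m 2 * (Z t - a) ^ m 3) = 1"
    using gauge_factor[OF as x(1)] sing[of x] x(3) unfolding Z_def by blast

  have "\<forall>\<^sub>F t in nhds x. Z t \<in> U"
    using x(3) by (intro eventually_analytic_in_open Z x(1) U(1)) (simp add: Z_def)
  hence "\<forall>\<^sub>F t in nhds x. t \<notin> period_lattice \<omega> \<and> u analytic_on {t} \<and> Z t \<in> U \<and> h analytic_on {t}
      \<and> (h t)\<^sup>2 * (Z t ^ m 1 * (Z t - 1) ^ m 2 * (Z t - a) ^ m 3) = 1"
    using eventually_notin_period_lattice[OF hp x(1)] h(2) eventually_analytic_at[OF h(1)]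
      eventually_analytic_at[OF x(2)] unfolding u_def by eventually_elim auto
  then obtain V where V: "open V" "x \<in> V"
    and VV: "\<And>t. t \<in> V \<Longrightarrow> t \<notin> period_lattice \<omega> \<and> u analytic_on {t} \<and> Z t \<in> U \<and> h analytic_on {t}
      \<and> (h t)\<^sup>2 * (Z t ^ m 1 * (Z t - 1) ^ m 2 * (Z t - a) ^ m 3) = 1"
    unfolding eventually_nhds by blast
  have near: "\<forall>\<^sub>F t' in nhds t. t' \<in> V" if "t \<in> V" for t
    using V(1) that by (rule eventually_nhds_in_open)
  have ZV: "Z analytic_on {t}" if "t \<in> V" for t using Z VV[OF that] by blast
  have comp: "(\<lambda>t. f (Z t)) analytic_on {t}" if "f holomorphic_on U" "t \<in> V" for f t
  proof -
    have "f analytic_on {Z t}" using that(1) U(1) VV[OF that(2)] analytic_at by blast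
    hence "(f \<circ> Z) analytic_on {t}" by (intro analytic_on_compose ZV that) auto
    thus ?thesis by (simp add: o_def)
  qed
  have FU: "F holomorphic_on U"
    using F U(1) by (auto simp: holomorphic_on_open)
  have \<Phi>an: "\<Phi> analytic_on {t}" if "t \<in> V" for t
    unfolding \<Phi>_def using VV[OF that] by (intro psi_hat_analytic[OF Psi_hat]) (auto simp: u_def)

  define L where "L = (\<lambda>z. z ^ m 1 * (z - 1) ^ m 2 * (z - a) ^ m 3 * (\<Prod>k=1..M. (z - b k) ^ (2 * n k)))"
  have B0: "B t \<noteq> 0" if "t \<in> V" for t
    unfolding B_def using VV[OF that] by (intro denominator_nonzero[OF sing]) auto
  have L: "(h t)\<^sup>2 * L (Z t) = (B t)\<^sup>2" if "t \<in> V" for t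
  proof -
    have "L (Z t) = Z t ^ m 1 * (Z t - 1) ^ m 2 * (Z t - a) ^ m 3 * (B t)\<^sup>2"
      by (simp only: L_def B_def power_even_eq prod_power_distrib)
    hence split: "(h t)\<^sup>2 * L (Z t)
        = (h t)\<^sup>2 * (Z t ^ m 1 * (Z t - 1) ^ m 2 * (Z t - a) ^ m 3) * (B t)\<^sup>2"
      by (simp only: mult.assoc)
    have "(h t)\<^sup>2 * (Z t ^ m 1 * (Z t - 1) ^ m 2 * (Z t - a) ^ m 3) = 1"
      using VV[OF that] by blast
    thus ?thesis unfolding split by (simp only: mult_1)
  qed
  have \<Psi>: "d ^ g * poly_lz \<Psi> lam (Z t) = L (Z t) * \<Phi> t" if "t \<in> V" for t
    using Psi_eq_leading_coefficient_times_psi_hat[OF Psi ne, of t lam] VV[OF that] 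
    unfolding poly_lead_coeff_Psi[OF Psi] by (simp add: L_def Z_def \<Phi>_def d_def u_def)
  have \<Phi>0: "\<Phi> t \<noteq> 0" if "t \<in> V" for t
    using \<Psi>[OF that] U(3) VV[OF that] d by auto

  define \<sigma> where "\<sigma> = (\<lambda>t. s (Z t) * h t / B t)"
  define W where "W = (\<lambda>t. \<i> * \<nu> / 2 * d ^ g * (deriv Z t / r (Z t)))"
  define \<psi> where "\<psi> = (\<lambda>t. s (Z t) * exp (\<i> * \<nu> / 2 * F (Z t)) * h t / B t)"
  have \<psi>: "\<psi> = (\<lambda>t. \<sigma> t * exp (\<i> * \<nu> / 2 * F (Z t)))"
    by (simp add: \<psi>_def \<sigma>_def mult_ac)
  have Ban: "B analytic_on {t}" if "t \<in> V" for t
    unfolding B_def by (intro analytic_intros ZV that)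
  have \<sigma>an: "\<sigma> analytic_on {t}" if "t \<in> V" for t
    unfolding \<sigma>_def using B0[OF that] VV[OF that] by (intro analytic_intros comp[OF s(1)] Ban that) auto
  have r0: "r (Z t) \<noteq> 0" if "t \<in> V" for t
    using r(2) VV[OF that] sing[of t] by (auto simp: fuchs_singularities_def)
  have Wan: "W analytic_on {x}"
    unfolding W_def using r0[OF V(2)] by (intro analytic_intros comp[OF r(1)] ZV V(2)) auto

  \<comment> \<open>The factor \<open>\<i>\<^sup>2 = -1\<close> turns \<open>4 (e\<^sub>2 - e\<^sub>1)\<close> into \<open>4 (e\<^sub>1 - e\<^sub>2)\<close>, which supplies the odd power of \<open>d\<close>.\<close>
  have W2: "(W t)\<^sup>2 = d ^ (2 * g + 1) * \<nu>\<^sup>2" if "t \<in> V" for t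
  proof -
    have "(deriv Z t)\<^sup>2 = - 4 * d * (r (Z t))\<^sup>2"
      using z_of_x_differential_equation[OF as, of t] sing[of t] VV[OF that] r(2) 
      by (simp add: Z_def d_def)
    hence quot: "(deriv Z t / r (Z t))\<^sup>2 = - 4 * d"
      using r0[OF that] by (simp add: power_divide)
    have "(W t)\<^sup>2 = (\<i> * \<nu> / 2)\<^sup>2 * (d ^ g)\<^sup>2 * (deriv Z t / r (Z t))\<^sup>2"
      by (simp only: W_def power_mult_distrib)
    also have "\<dots> = d ^ (2 * g + 1) * \<nu>\<^sup>2"
      unfolding quot by (simp add: power_even_eq power_mult_distrib power_divide)
    finally show ?thesis .
  qed
  have dW: "deriv W x = 0"
    by (rule deriv_zero_if_square_constant[OF Wan eventually_mono[OF near[OF V(2)] W2]])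

  have first: "2 * \<Phi> t * deriv \<psi> t = (deriv \<Phi> t + 2 * W t) * \<psi> t" if t: "t \<in> V" for t
  proof -
    define e where "e = exp (\<i> * \<nu> / 2 * F (Z t))"
    have "d ^ g * (\<sigma> t')\<^sup>2 = \<Phi> t'" if "t' \<in> V" for t'
    proof -
      have "d ^ g * (\<sigma> t')\<^sup>2 = d ^ g * poly_lz \<Psi> lam (Z t') * ((h t')\<^sup>2 / (B t')\<^sup>2)"
        using s(2) VV[OF that] by (simp add: \<sigma>_def power_mult_distrib power_divide)
      also have "\<dots> = \<Phi> t' * (((h t')\<^sup>2 * L (Z t')) / (B t')\<^sup>2)"
        unfolding \<Psi>[OF that] by simp
      finally show ?thesis using B0[OF that] by (simp add: L[OF that])
    qed
    hence "\<forall>\<^sub>F t' in nhds t. d ^ g * (\<sigma> t')\<^sup>2 = \<Phi> t'"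
      using near[OF t] by (rule eventually_mono[rotated])
    hence d\<sigma>: "2 * \<Phi> t * deriv \<sigma> t = deriv \<Phi> t * \<sigma> t"
      using d by (intro deriv_of_square_root[of _ _ _ "d ^ g"] \<sigma>an \<Phi>an t) auto
    have tU: "Z t \<in> U" using VV[OF t] by blast
    have "L (Z t) / poly_lz \<Psi> lam (Z t) = d ^ g / \<Phi> t"
      using \<Psi>[OF t] \<Phi>0[OF t] U(3) tU by (simp add: field_simps)
    hence "L (Z t) / (poly_lz \<Psi> lam (Z t) * r (Z t)) = d ^ g / \<Phi> t / r (Z t)"
      by (metis divide_divide_eq_left)
    hence "(F has_field_derivative d ^ g / \<Phi> t / r (Z t)) (at (Z t))"
      using F tU by (metis L_def)
    hence "((\<lambda>t. F (Z t)) has_field_derivative (d ^ g / \<Phi> t / r (Z t)) * deriv Z t) (at t)"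
      by (rule DERIV_chain2) (rule analytic_derivI[OF ZV[OF t]])
    hence "((\<lambda>t. \<i> * \<nu> / 2 * F (Z t)) has_field_derivative W t / \<Phi> t) (at t)"
      by (rule DERIV_cmult[THEN DERIV_cong]) (simp add: W_def mult_ac)
    hence "((\<lambda>t. exp (\<i> * \<nu> / 2 * F (Z t))) has_field_derivative e * (W t / \<Phi> t)) (at t)"
      unfolding e_def by (rule DERIV_fun_exp)
    hence "(\<psi> has_field_derivative deriv \<sigma> t * e + e * (W t / \<Phi> t) * \<sigma> t) (at t)"
      unfolding \<psi> e_def by (rule DERIV_mult[OF analytic_derivI[OF \<sigma>an[OF t]]])
    hence d\<psi>: "deriv \<psi> t = deriv \<sigma> t * e + e * (W t / \<Phi> t) * \<sigma> t"
      by (rule DERIV_imp_deriv)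
    have "2 * \<Phi> t * deriv \<psi> t = (2 * \<Phi> t * deriv \<sigma> t) * e + 2 * W t * e * \<sigma> t"
      unfolding d\<psi> using \<Phi>0[OF t] by (simp add: distrib_left mult_ac)
    also have "\<dots> = (deriv \<Phi> t + 2 * W t) * \<psi> t"
      unfolding d\<sigma> by (simp add: \<psi> e_def algebra_simps)
    finally show ?thesis .
  qed

  have "(W x)\<^sup>2 = (\<Prod>j=1..2*g+1. E_of_lambda \<omega> \<kappa> lam - Ed j)"
    unfolding W2[OF V(2)] curve d_def by (rule curve_in_energy[OF ne, symmetric])
  also have "\<dots> = spectral_w2 u g \<gamma> x (E_of_lambda \<omega> \<kappa> lam)"
    using edges x(2) by (simp add: gap_edges_def u_def)
  also have "\<dots> = (u x + E_of_lambda \<omega> \<kappa> lam) * (\<Phi> x)\<^sup>2 + 1/4 * (deriv \<Phi> x)\<^sup>2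
      - 1/2 * deriv (deriv \<Phi>) x * \<Phi> x"
    by (simp add: spectral_w2_def \<Phi>_def numeral_2_eq_2)
  finally have Wx: "(W x)\<^sup>2 = \<dots>" .
  have "\<psi> analytic_on {x}"
    unfolding \<psi> by (intro analytic_intros \<sigma>an comp[OF FU] V(2))
  hence ode: "deriv (deriv \<psi>) x = (u x + E_of_lambda \<omega> \<kappa> lam) * \<psi> x"
    by (rule second_order_equation_from_first_order[OF _ \<Phi>an[OF V(2)] Wan dW
          eventually_mono[OF near[OF V(2)] first] \<Phi>0[OF V(2)] Wx])
  have "(\<lambda>z. s z * exp (\<i> * \<nu> / 2 * F z)) holomorphic_on U"
    by (intro holomorphic_intros s(1) FU)
  hence an: "(\<lambda>z. s z * exp (\<i> * \<nu> / 2 * F z)) analytic_on {z_of_x \<omega> x}"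
    using U(1) x(3) analytic_at by blast
  show ?thesis
  proof (rule iffD1[OF schroedinger_iff_fuchsian[OF as x(1) _ h(1) _ an]])
    show "z_of_x \<omega> x \<notin> fuchs_singularities a M n b"
      using sing[of x] x(3) unfolding Z_def by blast
  qed (use h(2) ode in \<open>unfold Z_def \<psi>_def u_def B_def\<close>)
qed

text \<open>
  At a point \<open>b\<^sub>k\<close> with \<open>n\<^sub>k = 0\<close>, which may lie in \<open>U\<close>, the corresponding fractions are constantly 0.
\<close>
lemma fuchs_defect_continuous:
  assumes "open U" "U \<inter> fuchs_singularities a M n b = {}" "y holomorphic_on U"
  shows "continuous_on U
    (\<lambda>z. deriv (deriv y) z + fuchs_P a m M n b z * deriv y z + fuchs_Q a m M n b lam z * y z)"
proof -
  have frac: "continuous_on U (\<lambda>z. c / (z - b k))" if "k \<in> {1..M}" "n k = 0 \<Longrightarrow> c = 0" for k c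
  proof (cases "n k = 0")
    case True
    thus ?thesis using that(2) by simp
  next
    case False
    hence "b k \<notin> U"
      using assms(2) \<open>k \<in> {1..M}\<close> by (auto simp: fuchs_singularities_def)
    thus ?thesis by (intro continuous_intros) auto
  qed
  have sing: "0 \<notin> U" "1 \<notin> U" "a \<notin> U"
    using assms(2) by (auto simp: fuchs_singularities_def)
  have z: "z \<noteq> 0" "z \<noteq> 1" "z \<noteq> a" if "z \<in> U" for z using sing that by auto
  have sumP: "continuous_on U (\<lambda>z. \<Sum>k=1..M. of_nat (n k) / (z - b k))"
    by (rule continuous_on_sum, rule frac) auto
  have P: "continuous_on U (fuchs_P a m M n b)"
    unfolding fuchs_P_def[abs_def]
    by (intro continuous_on_diff continuous_on_mult continuous_on_const continuous_on_add sumP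
          continuous_on_divide continuous_on_id) (auto dest: z)
  have sumQ: "continuous_on U (\<lambda>z. \<Sum>k=1..M. of_nat (n k) * fuchs_rho a m M n b k / (z - b k))"
    by (rule continuous_on_sum, rule frac) auto
  have Q: "continuous_on U (fuchs_Q a m M n b lam)"
    unfolding fuchs_Q_def[abs_def] fuchs_R_def
    by (intro continuous_on_divide continuous_on_diff continuous_on_mult continuous_on_add sumQ
          continuous_on_const continuous_on_id) (auto dest: z)
  have y: "continuous_on U y" "continuous_on U (deriv y)" "continuous_on U (deriv (deriv y))"
    by (intro holomorphic_on_imp_continuous_on holomorphic_deriv assms)+
  show ?thesis
    by (intro continuous_on_add continuous_on_mult P Q y)
qed

text \<open>
  The left-hand side \<open>D\<close> of the Fuchsian equation is continuous on \<open>U\<close>, so it would be nonzero on a whole disc around a point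
  where it is nonzero. The disc contains the image of a regular point \<open>x\<close>, where \<open>D\<close> vanishes.
\<close>
lemma finite_gap_solution_on:
  fixes a \<kappa> lam \<nu> :: complex
  assumes a: "a \<noteq> 0"
    and as: "associated_schroedinger a m M n b \<omega> \<delta> \<kappa>"
    and Psi_hat: "psi_hat_solution (elliptic_potential \<omega> m M n \<delta>) g \<gamma>"
    and Psi: "is_Psi a m M n b \<omega> \<delta> \<kappa> g \<gamma> \<Psi>"
    and edges: "gap_edges (elliptic_potential \<omega> m M n \<delta>) g \<gamma> Ed"
    and curve: "\<nu>\<^sup>2 = (\<Prod>j=1..2*g+1. lam - lambda_of_E \<omega> \<kappa> (Ed j))"
    and U: "open U" "U \<inter> fuchs_singularities a M n b = {}" "\<forall>z\<in>U. poly_lz \<Psi> lam z \<noteq> 0"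
    and s: "s holomorphic_on U" "\<forall>z\<in>U. (s z)\<^sup>2 = poly_lz \<Psi> lam z"
    and r: "r holomorphic_on U" "\<forall>z\<in>U. (r z)\<^sup>2 = z * (z - 1) * (z - a)"
    and F: "\<forall>z\<in>U. (F has_field_derivative
          z ^ m 1 * (z - 1) ^ m 2 * (z - a) ^ m 3 * (\<Prod>k=1..M. (z - b k) ^ (2 * n k))
          / (poly_lz \<Psi> lam z * r z)) (at z)"
  shows "fuchs_solution_on a m M n b lam (\<lambda>z. s z * exp (\<i> * \<nu> / 2 * F z)) U"
proof -
  define y where "y = (\<lambda>z. s z * exp (\<i> * \<nu> / 2 * F z))"
  define D where
    "D = (\<lambda>z. deriv (deriv y) z + fuchs_P a m M n b z * deriv y z + fuchs_Q a m M n b lam z * y z)"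
  have "F holomorphic_on U"
    using F U(1) by (auto simp: holomorphic_on_open)
  hence y: "y holomorphic_on U"
    unfolding y_def by (intro holomorphic_intros s)
  have D: "continuous_on U D"
    unfolding D_def by (rule fuchs_defect_continuous[OF U(1,2) y])
  have hp: "half_periods \<omega>" using as by (simp add: associated_schroedinger_def)
  have "D z = 0" if z: "z \<in> U" for z
  proof (rule ccontr)
    assume "D z \<noteq> 0"
    then obtain \<epsilon>1 where \<epsilon>1: "\<epsilon>1 > 0" "\<And>v. dist z v < \<epsilon>1 \<Longrightarrow> D v \<noteq> 0"
      using continuous_on_open_avoid[OF D U(1) z] by blast
    obtain \<epsilon>2 where \<epsilon>2: "\<epsilon>2 > 0" "ball z \<epsilon>2 \<subseteq> U"
      using U(1) z by (rule openE)
    have min: "min \<epsilon>1 \<epsilon>2 > 0" using \<epsilon>1(1) \<epsilon>2(1) by simp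
    obtain x where x: "x \<notin> period_lattice \<omega>" "elliptic_potential \<omega> m M n \<delta> analytic_on {x}"
      "dist (z_of_x \<omega> x) z < min \<epsilon>1 \<epsilon>2"
      using regular_z_values_dense[OF hp half_period_values_distinct[OF as a] min, of m M n \<delta> z]
      by blast
    have zx: "z_of_x \<omega> x \<in> U" "D (z_of_x \<omega> x) \<noteq> 0"
      using \<epsilon>2(2) \<epsilon>1(2)[of "z_of_x \<omega> x"] x(3) by (auto simp: dist_commute)
    have "fuchs_eq_at a m M n b lam y (z_of_x \<omega> x)"
      unfolding y_def
      by (rule finite_gap_solution_at_regular_point[OF a as Psi_hat Psi edges curve U s r F x(1,2) zx(1)])
    thus False using zx(2) by (simp add: fuchs_eq_at_def D_def)
  qed
  thus ?thesis using y by (simp add: fuchs_solution_on_def fuchs_eq_at_def D_def y_def)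
qed

theorem theorem5:
  fixes a \<kappa> lam \<nu> :: complex
    and m n :: "nat \<Rightarrow> nat"
    and M g :: nat
    and b \<omega> \<delta> Ed :: "nat \<Rightarrow> complex"
    and \<gamma> :: "nat \<Rightarrow> complex \<Rightarrow> complex"
    and \<Psi> :: "complex poly poly"
    and U :: "complex set"
    and s r F :: "complex \<Rightarrow> complex"
  assumes "a \<noteq> 0" and "a \<noteq> 1"
    and "inj_on b {1..M}" and "\<forall>k\<in>{1..M}. b k \<notin> {0, 1, a}"
    and finite_gap_equation: "associated_schroedinger a m M n b \<omega> \<delta> \<kappa>"
      "finite_gap (elliptic_potential \<omega> m M n \<delta>)"
    and gap_number: "g_gap (elliptic_potential \<omega> m M n \<delta>) g"
    and Psi_hat: "psi_hat_solution (elliptic_potential \<omega> m M n \<delta>) g \<gamma>"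
    and Psi: "is_Psi a m M n b \<omega> \<delta> \<kappa> g \<gamma> \<Psi>"
    and edges: "gap_edges (elliptic_potential \<omega> m M n \<delta>) g \<gamma> Ed"
    and curve: "\<nu>\<^sup>2 = (\<Prod>j=1..2*g+1. lam - lambda_of_E \<omega> \<kappa> (Ed j))"
    and domain: "open U" "U \<inter> fuchs_singularities a M n b = {}"
      "\<forall>z\<in>U. poly_lz \<Psi> lam z \<noteq> 0"
    and sqrt_Psi: "s holomorphic_on U" "\<forall>z\<in>U. (s z)\<^sup>2 = poly_lz \<Psi> lam z"
    and sqrt_cubic: "r holomorphic_on U" "\<forall>z\<in>U. (r z)\<^sup>2 = z * (z - 1) * (z - a)"
    and integral: "\<forall>z\<in>U. (F has_field_derivative
          z ^ m 1 * (z - 1) ^ m 2 * (z - a) ^ m 3 * (\<Prod>k=1..M. (z - b k) ^ (2 * n k))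
          / (poly_lz \<Psi> lam z * r z)) (at z)"
  shows "fuchs_solution_on a m M n b lam (\<lambda>z. s z * exp (\<i> * \<nu> / 2 * F z)) U \<and>
         fuchs_solution_on a m M n b lam (\<lambda>z. s z * exp (- (\<i> * \<nu> / 2 * F z))) U"
proof
  let ?thm = "\<lambda>\<nu>. fuchs_solution_on a m M n b lam (\<lambda>z. s z * exp (\<i> * \<nu> / 2 * F z)) U"
  have sol: "?thm \<mu>" if "\<mu>\<^sup>2 = \<nu>\<^sup>2" for \<mu>
    by (rule finite_gap_solution_on[OF assms(1) finite_gap_equation(1) Psi_hat Psi edges _
          domain sqrt_Psi sqrt_cubic integral])
       (simp only: that curve)
  show "?thm \<nu>" by (rule sol) simp
  have "?thm (- \<nu>)" by (rule sol) simp
  thus "fuchs_solution_on a m M n b lam (\<lambda>z. s z * exp (- (\<i> * \<nu> / 2 * F z))) U" by simp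
qed

end
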